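(* Let $G$ be a connected simple graph of order $n$ with maximum degree $\Delta(G)$. Then $$h_p(G)\le \bigg\lfloor\frac{n-\Delta(G)}{3}\bigg\rfloor+3.$$
   Context: Graphs are finite and undirected. The line graph $L(G)$ has vertex set $E(G)$, two vertices being adjacent if and only if the corresponding edges of $G$ share an endpoint; $L^0(G)=G$, $L^1(G)=L(G)$, $L^m(G)=L(L^{m-1}(G))$ (with $L^{m-1}(G)$ assumed to have a nonempty edge set). A graph is traceable if it has a hamiltonian path. The hamiltonian path index $h_p(G)$ is the minimum integer $m\ge 0$ such that $L^m(G)$ is traceable (so $h_p(G)=0$ if $G$ is traceable). *)

theory Defs
  imports
    "Graph_Theory.Digraph_Component"
    "Graph_Theory.Digraph_Isomorphism"
    "Graph_Theory.Vertex_Walk"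
    "HOL-Library.FSet"
    "HOL-Library.Extended_Nat"
begin

text \<open>
  A finite simple undirected graph is a \<open>pair_graph\<close>: a finite, loop-free, symmetric digraph
  without parallel arcs. The two arcs \<open>(u, v)\<close> and \<open>(v, u)\<close> together stand for the one
  undirected edge \<open>{u, v}\<close>, so the degree of a vertex is its out-degree.
\<close>

definition edges :: "'a pair_pre_digraph \<Rightarrow> 'a set set" where
  "edges G = {{u, v} | u v. (u, v) \<in> parcs G}"

definition max_degree :: "'a pair_pre_digraph \<Rightarrow> nat" where
  "max_degree G = Max (out_degree (with_proj G) ` pverts G)"

text \<open>A \<open>vpath\<close> is nonempty, so the null graph is not traceable; one vertex alone is.\<close>

definition traceable :: "'a pair_pre_digraph \<Rightarrow> bool" where
  "traceable G \<longleftrightarrow> (\<exists>p. vpath p (with_proj G) \<and> set p = pverts G)"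

definition line_graph :: "'a pair_pre_digraph \<Rightarrow> 'a set pair_pre_digraph" where
  "line_graph G =
    \<lparr> pverts = edges G,
      parcs = {(e, f). e \<in> edges G \<and> f \<in> edges G \<and> e \<noteq> f \<and> e \<inter> f \<noteq> {}} \<rparr>"

text \<open>
  Each application of \<open>line_graph\<close> changes the vertex type. To iterate it, all the graphs
  are placed on one type, whose elements are the vertices of the original graph together
  with the finite sets built from them; the vertices are renamed along an injection.
\<close>

datatype 'a hvertex = Vertex 'a | Edge "'a hvertex fset"

definition relabel :: "('a \<Rightarrow> 'b) \<Rightarrow> 'a pair_pre_digraph \<Rightarrow> 'b pair_pre_digraph" where
  "relabel f G = \<lparr> pverts = f ` pverts G, parcs = map_prod f f ` parcs G \<rparr>"

definition edge_vertex :: "'a hvertex set \<Rightarrow> 'a hvertex" where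
  "edge_vertex e = Edge (Abs_fset e)"

primrec iter_line_graph :: "nat \<Rightarrow> 'a pair_pre_digraph \<Rightarrow> 'a hvertex pair_pre_digraph" where
  "iter_line_graph 0 G = relabel Vertex G"
| "iter_line_graph (Suc m) G = relabel edge_vertex (line_graph (iter_line_graph m G))"

text \<open>
  The index is the least \<open>m\<close> for which the \<open>m\<close>-th iterated line graph is defined and
  traceable. It is \<open>\<infinity>\<close> if there is none, so that a finite upper bound includes existence.
\<close>

definition ham_path_index :: "'a pair_pre_digraph \<Rightarrow> enat" where
  "ham_path_index G =
    Inf {enat m | m. (\<forall>i<m. edges (iter_line_graph i G) \<noteq> {}) \<and> traceable (iter_line_graph m G)}"


text \<open>The renamings do not change the graphs up to isomorphism.\<close>

lemma pair_graph_line_graph: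
  assumes "pair_graph G"
  shows "pair_graph (line_graph G)"
proof -
  interpret pair_graph G by fact
  have "edges G = (\<lambda>(u, v). {u, v}) ` parcs G"
    by (auto simp: edges_def)
  then have fin: "finite (edges G)"
    using pair_finite_arcs by simp
  have "finite (parcs (line_graph G))"
    by (rule finite_subset[of _ "edges G \<times> edges G"]) (auto simp: line_graph_def fin)
  then show ?thesis
    by unfold_locales (auto simp: line_graph_def fin symmetric_def sym_def)
qed

lemma pair_graph_relabel:
  assumes "pair_graph G" and inj: "inj_on f (pverts G)"
  shows "pair_graph (relabel f G)"
proof -
  interpret pair_graph G by fact
  show ?thesis
  proof unfold_locales
    show "symmetric (with_proj (relabel f G))"
      using arcs_symmetric by (force simp: relabel_def symmetric_def sym_def)
    show "fst e \<noteq> snd e" if "e \<in> parcs (relabel f G)" for e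
      using that inj no_loops' in_arcsD1 in_arcsD2
      by (fastforce simp: relabel_def dest: inj_onD)
  qed (use in_arcsD1 in_arcsD2 pair_finite_verts pair_finite_arcs in
      \<open>auto simp: relabel_def\<close>)
qed

lemma digraph_iso_relabel:
  assumes "pair_graph G" and inj: "inj_on f (pverts G)"
  shows "digraph_iso (with_proj G) (with_proj (relabel f G))"
proof -
  interpret pair_graph G by fact
  let ?h = "\<lparr> iso_verts = f, iso_arcs = map_prod f f, iso_head = snd, iso_tail = fst \<rparr>"
  have "inj_on (map_prod f f) (parcs G)"
    using inj in_arcsD1 in_arcsD2 by (auto simp: inj_on_def)
  moreover have "wf_digraph (with_proj G)"
    by unfold_locales
  ultimately have "pre_digraph.digraph_isomorphism (with_proj G) ?h"
    using inj by (simp add: pre_digraph.digraph_isomorphism_def)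
  moreover have "with_proj (relabel f G) = app_iso ?h (with_proj G)"
    by (simp add: app_iso_def with_proj_def relabel_def)
  ultimately show ?thesis
    unfolding digraph_iso_def by blast
qed

lemma inj_on_edge_vertex: "inj_on edge_vertex (edges G)"
proof (rule inj_onI)
  fix e f assume "e \<in> edges G" "f \<in> edges G" "edge_vertex e = edge_vertex f"
  then show "e = f"
    by (auto simp: edge_vertex_def edges_def Abs_fset_inject)
qed

lemma pair_graph_iter_line_graph:
  assumes "pair_graph G"
  shows "pair_graph (iter_line_graph m G)"
proof (induction m)
  case 0
  show ?case using assms by (simp add: pair_graph_relabel inj_on_def)
next
  case (Suc m)
  then show ?case
    by (auto intro!: pair_graph_relabel pair_graph_line_graph inj_on_edge_vertex
        simp: line_graph_def[THEN arg_cong[of _ _ pverts]])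
qed

lemma iter_line_graph_0_iso:
  "pair_graph G \<Longrightarrow> digraph_iso (with_proj G) (with_proj (iter_line_graph 0 G))"
  by (simp add: digraph_iso_relabel inj_on_def)

lemma iter_line_graph_Suc_iso:
  assumes "pair_graph G"
  shows "digraph_iso (with_proj (line_graph (iter_line_graph m G)))
    (with_proj (iter_line_graph (Suc m) G))"
  using digraph_iso_relabel[OF pair_graph_line_graph[OF pair_graph_iter_line_graph[OF assms]]]
    inj_on_edge_vertex[of "iter_line_graph m G"]
  by (simp add: line_graph_def)

end

theory Submission
  imports Defs
begin

text \<open>
  Call a vertex thin if it has degree at most two and lies in no triangle. The thin vertices of
  \<open>L(G)\<close> are edges between thin vertices of \<open>G\<close>, so each application of \<open>L\<close> shortens every
  component of the thin vertices, which is a path, by one vertex. Let \<open>v\<close> have degree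
  \<open>\<Delta> \<ge> 3\<close> and \<open>q = \<lfloor>(n - \<Delta>) / 3\<rfloor>\<close>. Apart from short cycles through \<open>v\<close>, counting vertices leaves room
  for at most two components with \<open>q + 2\<close> or more vertices, and some path of \<open>G\<close> passes
  through both. In \<open>K = L\<^sup>q\<^sup>+\<^sup>1(G)\<close> the path still contains all thin vertices except
  remainders of the short cycles, and deleting those remainders does not disconnect \<open>K\<close>. The path
  becomes a trail in \<open>L(K)\<close>: at each of its vertices all other edges of \<open>K\<close> at that vertex are
  inserted. The edges of \<open>K\<close> at a vertex of degree at least three off the path form a clique of \<open>L(K)\<close>,
  and a cycle through this clique is spliced in. The result is a dominating trail of \<open>L(K)\<close>, and hence
  \<open>L\<^sup>2(K) = L\<^sup>q\<^sup>+\<^sup>3(G)\<close> is traceable.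
\<close>

section \<open>Walks and dominating trails\<close>

text \<open>Undirected edges are listed instead of arcs, so that
  \<open>distinct (walk_edges xs)\<close> forbids reusing an edge in either direction and thus
  expresses that \<open>xs\<close> is a trail.\<close>

fun walk_edges :: "'a list \<Rightarrow> 'a set list" where
  "walk_edges (x # y # zs) = {x, y} # walk_edges (y # zs)"
| "walk_edges _ = []"

lemma walk_edges_append:
  "walk_edges (xs @ y # ys) = walk_edges (xs @ [y]) @ walk_edges (y # ys)"
  by (induction xs rule: walk_edges.induct) auto

lemma walk_edges_append_subset: "set (walk_edges ys) \<subseteq> set (walk_edges (xs @ ys))"
proof (cases ys)
  case (Cons y zs)
  then show ?thesis using walk_edges_append[of xs y zs] by simp
qed simp

lemma walk_edges_subset: "e \<in> set (walk_edges xs) \<Longrightarrow> e \<subseteq> set xs"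
  by (induction xs rule: walk_edges.induct) auto

lemma distinct_walk_edges: "distinct xs \<Longrightarrow> distinct (walk_edges xs)"
  by (induction xs rule: walk_edges.induct) (auto dest: walk_edges_subset)

lemma walk_edges_map: "walk_edges (map f xs) = map ((`) f) (walk_edges xs)"
  by (induction xs rule: walk_edges.induct) auto

lemma walk_edges_rev: "walk_edges (rev xs) = rev (walk_edges xs)"
proof (induction xs rule: walk_edges.induct)
  case (1 x y zs)
  then show ?case by (auto simp: walk_edges_append[of "rev zs" y "[x]"])
qed auto

lemma walk_edges_tl:
  assumes "distinct (x # xs)" "f \<in> set (walk_edges (x # xs))" "x \<in> f"
  shows "xs \<noteq> [] \<and> f = {x, hd xs}"
proof (cases xs)
  case (Cons a list)
  then have "f \<notin> set (walk_edges (a # list))"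
    using assms(1,3) walk_edges_subset[of f "a # list"] by auto
  then show ?thesis using assms(2) Cons by simp
qed (use assms in simp)

text \<open>No vertex of a path recurs, so two of its edges can meet only if they are consecutive.
  The path of these edges in the line graph is therefore induced, which lets the covering of edges
  in \<open>path_covered\<close> survive a step.\<close>

lemma walk_edges_walk_edges:
  assumes "distinct xs" "e \<in> set (walk_edges xs)" "f \<in> set (walk_edges xs)" "e \<noteq> f" "e \<inter> f \<noteq> {}"
  shows "{e, f} \<in> set (walk_edges (walk_edges xs))"
  using assms
proof (induction xs rule: walk_edges.induct)
  case (1 x y zs)
  \<comment> \<open>As \<open>x\<close> does not recur, \<open>g\<close> meets the first edge in
    \<open>y\<close> and is the first edge of the remaining path.\<close>
  have *: "{{x, y}, g} \<in> set (walk_edges (walk_edges (x # y # zs)))"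
    if "g \<in> set (walk_edges (y # zs))" "{x, y} \<inter> g \<noteq> {}" for g
  proof -
    have "x \<notin> g" using walk_edges_subset[OF that(1)] 1(2) by auto
    then have "y \<in> g" using that(2) by auto
    then have "zs \<noteq> [] \<and> g = {y, hd zs}" using that(1) 1(2) by (intro walk_edges_tl) auto
    then show ?thesis by (cases zs) auto
  qed
  have **: "{e, f} \<in> set (walk_edges (walk_edges (y # zs)))" if "e \<noteq> {x,y}" "f \<noteq> {x,y}"
    using 1 that by auto
  have sub: "set (walk_edges (walk_edges (y # zs))) \<subseteq> set (walk_edges (walk_edges (x # y # zs)))"
    using walk_edges_append_subset[of "walk_edges (y # zs)" "[{x, y}]"] by simp
  show ?case
  proof (cases "e = {x, y} \<or> f = {x, y}")
    case True
    then show ?thesis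
    proof
      assume "e = {x, y}"
      then show ?thesis using *[of f] 1(4-6) by simp
    next
      assume "f = {x, y}"
      then show ?thesis using *[of e] 1(3,5,6) by (simp add: insert_commute Int_commute)
    qed
  next
    case False
    then show ?thesis using ** sub by blast
  qed
qed auto

section \<open>Edges of a simple graph as two-element sets\<close>

context pair_graph begin

lemma arc_sym: "(u, v) \<in> parcs G \<Longrightarrow> (v, u) \<in> parcs G"
  using arcs_symmetric by blast

lemma edges_iff [simp]: "{u, v} \<in> edges G \<longleftrightarrow> (u, v) \<in> parcs G"
  unfolding edges_def by (simp add: doubleton_eq_iff) (metis arc_sym)

lemma arc_neq: "(u, v) \<in> parcs G \<Longrightarrow> u \<noteq> v"
  using no_loops'[of u] by blast

lemma edgesE:
  assumes "e \<in> edges G"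
  obtains u v where "e = {u, v}" "(u, v) \<in> parcs G" "u \<noteq> v" "u \<in> pverts G" "v \<in> pverts G"
proof -
  obtain u v where "e = {u, v}" "(u, v) \<in> parcs G"
    using assms unfolding edges_def by blast
  then show ?thesis using that[of u v] arc_neq[of u v] in_arcsD1[of u v] in_arcsD2[of u v] by simp
qed

lemma edgesE_at:
  assumes "e \<in> edges G" "u \<in> e"
  obtains v where "e = {u, v}" "(u, v) \<in> parcs G" "u \<noteq> v" "u \<in> pverts G" "v \<in> pverts G"
proof -
  obtain a b where e: "e = {a, b}" "(a, b) \<in> parcs G" "a \<noteq> b" "a \<in> pverts G" "b \<in> pverts G"
    using assms(1) by (rule edgesE)
  show ?thesis
  proof (cases "u = a")
    case True then show ?thesis using that[of b] e by auto
  next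
    case False
    then have "u = b" using e assms by auto
    then show ?thesis using that[of a] e arc_sym by (auto simp: insert_commute)
  qed
qed

lemma finite_edges: "finite (edges G)"
proof -
  have "edges G = (\<lambda>(u, v). {u, v}) ` parcs G"
    unfolding edges_def by fast
  then show ?thesis using pair_finite_arcs by simp
qed

lemma edges_eq_if_Int:
  assumes "e \<in> edges G" "f \<in> edges G" "u \<in> e" "v \<in> e" "u \<in> f" "v \<in> f" "u \<noteq> v"
  shows "e = f"
proof -
  have "g = {u, v}" if "g \<in> edges G" "u \<in> g" "v \<in> g" for g
    using that assms(7) by (elim edgesE_at[of g u]) auto
  then show ?thesis using assms by metis
qed

end

section \<open>Line graphs and renaming of vertices\<close>

lemma edges_relabel: "edges (relabel \<phi> G) = (`) \<phi> ` edges G"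
proof (intro equalityI subsetI)
  fix e assume "e \<in> edges (relabel \<phi> G)"
  then obtain u v where "e = {\<phi> u, \<phi> v}" "(u, v) \<in> parcs G"
    unfolding edges_def relabel_def by auto
  then show "e \<in> (`) \<phi> ` edges G"
    unfolding edges_def by (intro image_eqI[of _ _ "{u, v}"]) auto
next
  fix e assume "e \<in> (`) \<phi> ` edges G"
  then obtain u v where "e = {\<phi> u, \<phi> v}" "(u, v) \<in> parcs G"
    unfolding edges_def by auto
  then show "e \<in> edges (relabel \<phi> G)"
    unfolding edges_def relabel_def by force
qed

lemma parcs_line_graph:
  "parcs (line_graph G) = {(e, f). e \<in> edges G \<and> f \<in> edges G \<and> e \<noteq> f \<and> e \<inter> f \<noteq> {}}"
  by (simp add: line_graph_def)

lemma edges_line_graph: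
  "edges (line_graph G) = {{e, f} | e f. e \<in> edges G \<and> f \<in> edges G \<and> e \<noteq> f \<and> e \<inter> f \<noteq> {}}"
  unfolding edges_def[of "line_graph G"] by (simp add: line_graph_def)

lemma pverts_line_graph [simp]: "pverts (line_graph G) = edges G"
  by (simp add: line_graph_def)

lemma pverts_relabel [simp]: "pverts (relabel \<phi> G) = \<phi> ` pverts G"
  by (simp add: relabel_def)

lemma parcs_relabel [simp]: "parcs (relabel \<phi> G) = map_prod \<phi> \<phi> ` parcs G"
  by (simp add: relabel_def)

lemma vwalk_arcs_map: "vwalk_arcs (map f p) = map (map_prod f f) (vwalk_arcs p)"
  by (induction p rule: vwalk_arcs.induct) auto

lemma traceable_relabel:
  assumes "traceable G" "inj_on \<phi> (pverts G)"
  shows "traceable (relabel \<phi> G)"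
proof -
  obtain p where "vpath p (with_proj G)" "set p = pverts G"
    using assms unfolding traceable_def by blast
  then have "vpath (map \<phi> p) (with_proj (relabel \<phi> G))" "set (map \<phi> p) = pverts (relabel \<phi> G)"
    using assms(2)
    by (auto simp: vpath_def vwalk_def vwalk_arcs_map distinct_map)
  then show ?thesis unfolding traceable_def by blast
qed

text \<open>Domination is meant as in the theorem of Harary and Nash-Williams. Vertices of
  \<open>xs\<close> may repeat, and a single vertex is a trail without edges, so that a star is
  dominated by its centre.\<close>

definition dominating_trail :: "'a pair_pre_digraph \<Rightarrow> 'a list \<Rightarrow> bool" where
  "dominating_trail G xs \<longleftrightarrow> distinct (walk_edges xs) \<and> set (walk_edges xs) \<subseteq> edges G \<and>
     (\<forall>e\<in>edges G. e \<inter> set xs \<noteq> {})"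

lemma dominating_trail_relabel:
  assumes "pair_graph G" "dominating_trail G xs" "inj_on \<phi> (pverts G)" "set xs \<subseteq> pverts G"
  shows "dominating_trail (relabel \<phi> G) (map \<phi> xs)"
proof -
  interpret pair_graph G by fact
  have "edges G \<subseteq> Pow (pverts G)" by (blast elim: edgesE)
  then have "inj_on ((`) \<phi>) (edges G)"
    using inj_on_image_Pow[OF assms(3)] inj_on_subset by blast
  then have "inj_on ((`) \<phi>) (set (walk_edges xs))"
    using assms(2) inj_on_subset unfolding dominating_trail_def by blast
  then show ?thesis
    using assms(2) unfolding dominating_trail_def
    by (auto simp: walk_edges_map edges_relabel distinct_map)
qed

lemma successively_appendI:
  assumes "\<And>a b. a \<in> set as \<Longrightarrow> b \<in> set as \<Longrightarrow> P a b" "successively P bs"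
    "\<And>a. a \<in> set as \<Longrightarrow> bs \<noteq> [] \<Longrightarrow> P a (hd bs)"
  shows "successively P (as @ bs)"
proof -
  have "successively P as"
    using assms(1) by (induction as rule: induct_list012) simp_all
  then show ?thesis
    using assms(2) assms(3)[of "last as"] by (cases "as = []"; cases "bs = []") (simp_all add: successively_append_iff)
qed

lemma vwalk_arcs_successively:
  "\<lbrakk>successively P p; distinct p; (a, b) \<in> set (vwalk_arcs p)\<rbrakk> \<Longrightarrow> P a b \<and> a \<in> set p \<and> b \<in> set p \<and> a \<noteq> b"
  by (induction p rule: vwalk_arcs.induct) auto

text \<open>The edges off the trail are listed at the first trail vertex that they contain.\<close>

lemma ordering_of_dominated_edges:
  assumes "finite F" "distinct (walk_edges xs)" "F \<inter> set (walk_edges xs) = {}"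
    "\<And>f. f \<in> F \<Longrightarrow> \<exists>x\<in>set xs. x \<in> f"
  shows "\<exists>p. distinct p \<and> set p = F \<union> set (walk_edges xs) \<and>
    successively (\<lambda>e f. \<exists>x. x \<in> e \<and> x \<in> f) p \<and> (p \<noteq> [] \<longrightarrow> xs \<noteq> [] \<and> hd xs \<in> hd p)"
  using assms
proof (induction xs arbitrary: F)
  case Nil
  then show ?case by (intro exI[of _ "[]"]) auto
next
  case (Cons x xs)
  let ?M = "\<lambda>e f. \<exists>x::'a. x \<in> e \<and> x \<in> f"
  \<comment> \<open>The edges in \<open>as\<close> share \<open>x\<close>, so their order is free.
    The claim about \<open>hd p\<close> strengthens the induction: it allows such a block to be
    attached in front.\<close>
  obtain as where as: "set as = {f \<in> F. x \<in> f}" "distinct as"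
    using Cons.prems(1) finite_distinct_list[of "{f \<in> F. x \<in> f}"] by auto
  have arcs: "successively ?M (as @ p)" if "successively ?M p" "p \<noteq> [] \<Longrightarrow> x \<in> hd p" for p
    using that as(1) by (intro successively_appendI) blast+
  show ?case
  proof (cases xs)
    case Nil
    then have F: "F = set as" using Cons.prems(4) as(1) by auto
    have "x \<in> hd as" if "as \<noteq> []" using as(1) hd_in_set[OF that] by blast
    moreover have "successively ?M as" using arcs[of "[]"] by simp
    ultimately show ?thesis using F as(2) Nil by (intro exI[of _ as]) simp
  next
    case (Cons y zs)
    let ?F = "{f \<in> F. x \<notin> f}"
    have "\<exists>p. distinct p \<and> set p = ?F \<union> set (walk_edges xs) \<and>
      successively ?M p \<and> (p \<noteq> [] \<longrightarrow> xs \<noteq> [] \<and> hd xs \<in> hd p)"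
    proof (rule Cons.IH)
      show "finite ?F" using Cons.prems(1) by simp
      show "distinct (walk_edges xs)" using Cons.prems(2) Cons by simp
      show "?F \<inter> set (walk_edges xs) = {}" using Cons.prems(3) Cons by auto
      show "\<exists>x\<in>set xs. x \<in> f" if "f \<in> ?F" for f using Cons.prems(4)[of f] that by auto
    qed
    then obtain p where p: "distinct p" "set p = ?F \<union> set (walk_edges xs)"
      "successively ?M p" "p \<noteq> [] \<longrightarrow> y \<in> hd p"
      using Cons by auto
    \<comment> \<open>The trail edge is the link: it meets \<open>as\<close> in \<open>x\<close>
      and, by the induction hypothesis, the head of \<open>p\<close> in \<open>y\<close>.\<close>
    let ?p = "{x, y} # p"
    have "successively ?M ?p"
      using p(3,4) by (cases p) auto
    then have "successively ?M (as @ ?p)"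
      by (intro arcs) simp_all
    moreover have "distinct (as @ ?p)"
    proof -
      have "{x, y} \<notin> F" "{x, y} \<notin> set (walk_edges xs)" using Cons.prems(2,3) Cons by simp_all
      moreover have "set as \<inter> set (walk_edges xs) = {}" using Cons.prems(3) Cons as(1) by auto
      ultimately show ?thesis using p(1,2) as by auto
    qed
    moreover have "set (as @ ?p) = F \<union> set (walk_edges (x # xs))"
      using p(2) as(1) Cons by auto
    moreover have "x \<in> hd (as @ ?p)"
    proof (cases as)
      case (Cons a bs)
      then have "a \<in> set as" by simp
      then have "x \<in> a" using as(1) by blast
      then show ?thesis using Cons by simp
    qed simp
    ultimately show ?thesis by (intro exI[of _ "as @ ?p"]) simp
  qed
qed

text \<open>One direction of the path version of the Harary-Nash-Williams theorem. The edge set is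
  assumed nonempty because the null graph is not traceable.\<close>

lemma traceable_line_graph_if_dominating_trail:
  assumes "pair_graph G" "dominating_trail G xs" "edges G \<noteq> {}"
  shows "traceable (line_graph G)"
proof -
  interpret pair_graph G by fact
  have sub: "set (walk_edges xs) \<subseteq> edges G" using assms(2) unfolding dominating_trail_def by blast
  have "\<exists>p. distinct p \<and> set p = (edges G - set (walk_edges xs)) \<union> set (walk_edges xs) \<and>
    successively (\<lambda>e f. \<exists>x. x \<in> e \<and> x \<in> f) p \<and> (p \<noteq> [] \<longrightarrow> xs \<noteq> [] \<and> hd xs \<in> hd p)"
    using assms(2) finite_edges unfolding dominating_trail_def
    by (intro ordering_of_dominated_edges) blast+
  moreover have "(edges G - set (walk_edges xs)) \<union> set (walk_edges xs) = edges G" using sub by blast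
  ultimately obtain p where
    p: "distinct p" "set p = edges G" "successively (\<lambda>e f. \<exists>x. x \<in> e \<and> x \<in> f) p"
    by (elim exE conjE) simp
  have "set (vwalk_arcs p) \<subseteq> parcs (line_graph G)"
  proof (rule subrelI)
    fix e f assume "(e, f) \<in> set (vwalk_arcs p)"
    from vwalk_arcs_successively[OF p(3,1) this] obtain x
      where "x \<in> e" "x \<in> f" "e \<in> edges G" "f \<in> edges G" "e \<noteq> f"
      using p(2) by blast
    then show "(e, f) \<in> parcs (line_graph G)"
      unfolding parcs_line_graph by blast
  qed
  then have "vpath p (with_proj (line_graph G))"
    using p assms(3) by (simp add: vpath_def vwalk_def) (metis set_empty)
  then show ?thesis using p(2) unfolding traceable_def by auto
qed

section \<open>A dominating trail in the line graph\<close>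

definition nbhd :: "'a pair_pre_digraph \<Rightarrow> 'a \<Rightarrow> 'a set" where
  "nbhd G x = {y. (x, y) \<in> parcs G}"

lemma in_nbhd [simp]: "y \<in> nbhd G x \<longleftrightarrow> (x, y) \<in> parcs G"
  by (simp add: nbhd_def)

definition in_triangle :: "'a pair_pre_digraph \<Rightarrow> 'a \<Rightarrow> bool" where
  "in_triangle G x \<longleftrightarrow> (\<exists>a b. (x, a) \<in> parcs G \<and> (x, b) \<in> parcs G \<and> (a, b) \<in> parcs G)"

text \<open>For symmetric \<open>E\<close> this is connectivity of the subgraph induced on
  \<open>A\<close>, stated by closed sets: a connectivity argument then only has to exhibit a
  nonempty set that no arc inside \<open>A\<close> leaves. The empty set counts as
  connected.\<close>

definition connected_in :: "'a rel \<Rightarrow> 'a set \<Rightarrow> bool" where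
  "connected_in E A \<longleftrightarrow>
     (\<forall>S. S \<noteq> {} \<longrightarrow> S \<subseteq> A \<longrightarrow> (\<forall>x\<in>S. \<forall>y\<in>A. (x, y) \<in> E \<longrightarrow> y \<in> S) \<longrightarrow> S = A)"

lemma connected_inD:
  assumes "connected_in E A" "x \<in> S" "S \<subseteq> A" "\<And>x y. \<lbrakk>x \<in> S; y \<in> A; (x, y) \<in> E\<rbrakk> \<Longrightarrow> y \<in> S"
  shows "S = A"
  using assms unfolding connected_in_def by (metis empty_iff)

section \<open>Trails through the cliques of the line graph\<close>

definition incident_edges :: "'a pair_pre_digraph \<Rightarrow> 'a set \<Rightarrow> 'a set set" where
  "incident_edges G S = {e \<in> edges G. e \<inter> S \<noteq> {}}"

text \<open>The edges at a vertex of \<open>G\<close> form a clique of the line graph. These are the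
  edges of the line graph that lie in the cliques of the vertices in \<open>S\<close>.\<close>

definition meeting_pairs :: "'a pair_pre_digraph \<Rightarrow> 'a set \<Rightarrow> 'a set set set" where
  "meeting_pairs G S = {{e, f} | e f. e \<in> edges G \<and> f \<in> edges G \<and> e \<noteq> f \<and> e \<inter> f \<inter> S \<noteq> {}}"

lemma meeting_pairs_subset: "meeting_pairs G S \<subseteq> edges (line_graph G)"
  unfolding meeting_pairs_def edges_line_graph by blast

lemma meeting_pairs_Un: "meeting_pairs G (S \<union> T) = meeting_pairs G S \<union> meeting_pairs G T"
proof -
  have "e \<inter> f \<inter> (S \<union> T) \<noteq> {} \<longleftrightarrow> e \<inter> f \<inter> S \<noteq> {} \<or> e \<inter> f \<inter> T \<noteq> {}" for e f
    by blast
  then show ?thesis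
    unfolding meeting_pairs_def by (simp only: conj_disj_distribL ex_disj_distrib Collect_disj_eq)
qed

text \<open>The trail is confined to the cliques at \<open>S\<close> and visits all their vertices.
  The confinement makes trails for disjoint sets edge-disjoint, so that they can be joined.\<close>

definition star_trail :: "'a pair_pre_digraph \<Rightarrow> 'a set \<Rightarrow> 'a set list \<Rightarrow> bool" where
  "star_trail G S xs \<longleftrightarrow> distinct (walk_edges xs) \<and> set (walk_edges xs) \<subseteq> meeting_pairs G S \<and>
     set xs = incident_edges G S"

lemma walk_edges_distinctE:
  assumes "p \<in> set (walk_edges xs)" "distinct xs"
  shows "\<exists>a b. p = {a, b} \<and> a \<noteq> b \<and> a \<in> set xs \<and> b \<in> set xs"
  using assms
proof (induction xs rule: walk_edges.induct)
  case (1 x y zs)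
  show ?case
  proof (cases "p = {x, y}")
    case True
    then show ?thesis using 1(3) by (intro exI[of _ x] exI[of _ y]) simp
  next
    case False
    then obtain a b where "p = {a, b}" "a \<noteq> b" "a \<in> set (y # zs)" "b \<in> set (y # zs)"
      using 1 by auto
    then show ?thesis by (intro exI[of _ a] exI[of _ b]) simp
  qed
qed simp_all

context pair_graph begin

lemma finite_nbhd: "finite (nbhd G x)"
  by (rule finite_subset[OF _ pair_finite_verts]) (auto dest: in_arcsD2)

text \<open>In a simple graph two distinct edges share at most one vertex, so an edge of the line
  graph determines the clique to which it belongs.\<close>

lemma meeting_pairs_disjoint:
  assumes "S \<inter> T = {}"
  shows "meeting_pairs G S \<inter> meeting_pairs G T = {}"
proof -
  have False if "p \<in> meeting_pairs G S" "p \<in> meeting_pairs G T" for p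
  proof -
    obtain e f u where e: "p = {e, f}" "e \<in> edges G" "f \<in> edges G" "e \<noteq> f" "u \<in> e" "u \<in> f" "u \<in> S"
      using \<open>p \<in> meeting_pairs G S\<close> unfolding meeting_pairs_def by blast
    obtain e' f' v where f: "p = {e', f'}" "v \<in> e'" "v \<in> f'" "v \<in> T"
      using \<open>p \<in> meeting_pairs G T\<close> unfolding meeting_pairs_def by blast
    have "v \<in> e" "v \<in> f" "u \<noteq> v"
      using e f assms by (auto simp: doubleton_eq_iff)
    then show False
      using e edges_eq_if_Int[of e f u v] by blast
  qed
  then show ?thesis by blast
qed

lemma star_trail_append:
  assumes "star_trail G S (as @ [x])" "star_trail G T (x # bs)" "S \<inter> T = {}"
  shows "star_trail G (S \<union> T) (as @ x # bs)"
proof -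
  have "set (walk_edges (as @ [x])) \<inter> set (walk_edges (x # bs)) = {}"
    using assms meeting_pairs_disjoint[OF assms(3)] unfolding star_trail_def by blast
  moreover have "set (as @ x # bs) = set (as @ [x]) \<union> set (x # bs)" by auto
  moreover have "incident_edges G (S \<union> T) = incident_edges G S \<union> incident_edges G T"
    unfolding incident_edges_def by blast
  ultimately show ?thesis
    using assms(1,2) unfolding star_trail_def meeting_pairs_Un walk_edges_append[of as x bs]
    by (simp only: distinct_append set_append) blast
qed

text \<open>A closed trail can be inserted at any visit of its base \<open>x\<close>. This is how a
  further vertex of degree at least three is absorbed.\<close>

lemma star_trail_splice:
  assumes "star_trail G S (as @ x # bs)" "star_trail G T (x # cs @ [x])" "S \<inter> T = {}"
  shows "star_trail G (S \<union> T) (as @ x # cs @ x # bs)"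
proof -
  have S: "walk_edges (as @ x # bs) = walk_edges (as @ [x]) @ walk_edges (x # bs)"
    by (rule walk_edges_append)
  have ST: "walk_edges (as @ x # cs @ x # bs) =
    walk_edges (as @ [x]) @ walk_edges (x # cs @ [x]) @ walk_edges (x # bs)"
    using walk_edges_append[of as x "cs @ x # bs"] walk_edges_append[of "x # cs" x bs] by simp
  have "set (walk_edges (as @ x # bs)) \<inter> set (walk_edges (x # cs @ [x])) = {}"
    using assms meeting_pairs_disjoint[OF assms(3)] unfolding star_trail_def by blast
  moreover have "set (as @ x # cs @ x # bs) = set (as @ x # bs) \<union> set (x # cs @ [x])" by auto
  moreover have "incident_edges G (S \<union> T) = incident_edges G S \<union> incident_edges G T"
    unfolding incident_edges_def by blast
  ultimately show ?thesis
    using assms(1,2) unfolding star_trail_def meeting_pairs_Un ST S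
    by (simp only: distinct_append set_append) blast
qed

text \<open>The edges at \<open>w\<close> are pairwise adjacent in the line graph, so any ordering
  of them is a path there.\<close>

lemma star_trail_distinct:
  assumes "distinct xs" "set xs = incident_edges G {w}"
  shows "star_trail G {w} xs"
proof -
  have "p \<in> meeting_pairs G {w}" if p: "p \<in> set (walk_edges xs)" for p
  proof -
    obtain a b where "p = {a, b}" "a \<noteq> b" "a \<in> incident_edges G {w}" "b \<in> incident_edges G {w}"
      using walk_edges_distinctE[OF p assms(1)] assms(2) by auto
    then show ?thesis unfolding incident_edges_def meeting_pairs_def by blast
  qed
  then show ?thesis using assms distinct_walk_edges[OF assms(1)] unfolding star_trail_def by blast
qed

lemma finite_incident_edges: "finite (incident_edges G S)"
  using finite_edges unfolding incident_edges_def by simp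

lemma card_incident_edges: "card (incident_edges G {u}) = card (nbhd G u)"
proof -
  have "incident_edges G {u} = (\<lambda>v. {u, v}) ` nbhd G u"
  proof (intro equalityI subsetI)
    fix e assume "e \<in> incident_edges G {u}"
    then have "e \<in> edges G" "u \<in> e" unfolding incident_edges_def by auto
    then obtain v where "e = {u, v}" "(u, v) \<in> parcs G" by (rule edgesE_at)
    then show "e \<in> (\<lambda>v. {u, v}) ` nbhd G u" by simp
  qed (auto simp: incident_edges_def)
  moreover have "inj_on (\<lambda>v. {u, v}) (nbhd G u)"
    by (auto simp: inj_on_def doubleton_eq_iff)
  ultimately show ?thesis by (simp add: card_image)
qed

text \<open>The clique at \<open>u\<close> has at least three vertices and hence a hamiltonian cycle
  through \<open>x\<close>. With two other edges available, the edge that closes the cycle differs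
  from its first edge.\<close>

lemma star_trail_closed:
  assumes "x \<in> incident_edges G {u}" "3 \<le> card (nbhd G u)"
  shows "\<exists>cs. star_trail G {u} (x # cs @ [x])"
proof -
  obtain cs where cs: "set cs = incident_edges G {u} - {x}" "distinct cs"
    using finite_distinct_list[of "incident_edges G {u} - {x}"] finite_incident_edges by auto
  have "length cs = card (nbhd G u) - 1"
    using cs assms(1) distinct_card[OF cs(2)] finite_incident_edges
    by (simp add: card_incident_edges card_Diff_singleton)
  then obtain a b bs where cs_eq: "cs = a # b # bs"
    using assms(2) by (cases cs; cases "tl cs") auto
  obtain ds d where ds: "cs = a # ds @ [d]" using cs_eq
    by (metis append_butlast_last_id list.distinct(1))
  have 1: "star_trail G {u} (x # cs)"
    using cs assms(1) by (intro star_trail_distinct) auto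
  have eq: "walk_edges (x # cs @ [x]) = walk_edges (x # cs) @ [{d, x}]"
    using walk_edges_append[of "x # a # ds" d "[x]"] ds by simp
  have d: "d \<in> incident_edges G {u}" "d \<noteq> x" "d \<noteq> a" "d \<in> set cs" "x \<notin> set cs"
    using cs ds by auto
  have "{d, x} \<in> meeting_pairs G {u}"
    using d(1,2) assms(1) unfolding incident_edges_def meeting_pairs_def by blast
  moreover have "{d, x} \<notin> set (walk_edges (x # cs))"
  proof
    assume "{d, x} \<in> set (walk_edges (x # cs))"
    then have "{d, x} = {x, hd cs}" using walk_edges_tl[of x cs "{d, x}"] cs d by simp
    then show False using d cs_eq by (auto simp: doubleton_eq_iff)
  qed
  ultimately have "star_trail G {u} (x # cs @ [x])"
    using 1 unfolding star_trail_def eq by auto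
  then show ?thesis ..
qed

text \<open>The trail enters the clique at \<open>w\<close> by \<open>e\<close>, runs through the
  remaining edges at \<open>w\<close> and leaves by the path edge \<open>{w, v}\<close>, which
  serves as the entry at \<open>v\<close>. The entry is kept off the path so that it differs from
  the exit.\<close>

lemma star_trail_along_path:
  assumes "distinct (w # ws)" "set (walk_edges (w # ws)) \<subseteq> edges G" "e \<in> edges G" "w \<in> e"
    "e \<notin> set (walk_edges (w # ws))"
  shows "\<exists>xs. star_trail G (set (w # ws)) (e # xs)"
  using assms
proof (induction ws arbitrary: w e)
  case Nil
  obtain xs where "set xs = incident_edges G {w} - {e}" "distinct xs"
    using finite_distinct_list[of "incident_edges G {w} - {e}"] finite_incident_edges by auto
  moreover have "e \<in> incident_edges G {w}"
    using Nil.prems(3,4) by (simp add: incident_edges_def)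
  ultimately have "star_trail G {w} (e # xs)"
    by (intro star_trail_distinct) auto
  then show ?case by auto
next
  case (Cons v ws)
  let ?f = "{w, v}"
  have "?f \<notin> set (walk_edges (v # ws))"
    using Cons.prems(1) walk_edges_subset[of ?f "v # ws"] by auto
  then obtain ys where ys: "star_trail G (set (v # ws)) (?f # ys)"
    using Cons.IH[of v ?f] Cons.prems by auto
  obtain xs where xs: "set xs = incident_edges G {w} - {e, ?f}" "distinct xs"
    using finite_distinct_list[of "incident_edges G {w} - {e, ?f}"] finite_incident_edges by auto
  have e: "e \<in> incident_edges G {w}" "?f \<in> incident_edges G {w}" "e \<noteq> ?f"
    using Cons.prems(2-5) by (simp_all add: incident_edges_def)
  have "star_trail G {w} ((e # xs) @ [?f])"
  proof (rule star_trail_distinct)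
    show "distinct ((e # xs) @ [?f])" using xs e(3) by simp
    show "set ((e # xs) @ [?f]) = incident_edges G {w}" using xs(1) e(1,2) by auto
  qed
  from star_trail_append[OF this ys] have "star_trail G ({w} \<union> set (v # ws)) ((e # xs) @ ?f # ys)"
    using Cons.prems(1) by auto
  then show ?case by (intro exI[of _ "xs @ ?f # ys"]) (simp add: insert_commute)
qed

lemma star_trail_path:
  assumes "distinct W" "set (walk_edges W) \<subseteq> edges G"
  shows "\<exists>xs. star_trail G (set W) xs"
proof (cases W)
  case Nil
  then show ?thesis by (intro exI[of _ "[]"]) (simp add: star_trail_def incident_edges_def)
next
  case (Cons w ws)
  show ?thesis
  proof (cases "incident_edges G {w} \<subseteq> set (walk_edges W)")
    case False
    then obtain e where "e \<in> edges G" "w \<in> e" "e \<notin> set (walk_edges W)"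
      unfolding incident_edges_def by auto
    then show ?thesis using star_trail_along_path[of w ws e] assms Cons by blast
  next
    \<comment> \<open>Here no edge can serve as entry at \<open>w\<close>. The only possible edge at
      \<open>w\<close> is the first path edge, and the trail starts with it.\<close>
    case True
    have hd: "ws \<noteq> [] \<and> e = {w, hd ws}" if "e \<in> incident_edges G {w}" for e
      using that True assms(1) Cons walk_edges_tl[of w ws e] unfolding incident_edges_def by auto
    show ?thesis
    proof (cases ws)
      case Nil
      then have "incident_edges G {w} = {}" using hd by auto
      then have "star_trail G {w} []" by (intro star_trail_distinct) auto
      then show ?thesis using Nil Cons by auto
    next
      case (Cons v vs)
      have "{w, v} \<notin> set (walk_edges (v # vs))"
        using assms(1) \<open>W = w # ws\<close> Cons walk_edges_subset[of "{w, v}" "v # vs"] by auto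
      then obtain ys where "star_trail G (set (v # vs)) ({w, v} # ys)"
        using star_trail_along_path[of v vs "{w, v}"] assms \<open>W = w # ws\<close> Cons by auto
      moreover have "incident_edges G {w} = {{w, v}}"
        using hd Cons assms(2) \<open>W = w # ws\<close> unfolding incident_edges_def by auto
      then have "star_trail G {w} ([] @ [{w, v}])" by (intro star_trail_distinct) auto
      ultimately have "star_trail G ({w} \<union> set (v # vs)) ([] @ {w, v} # ys)"
        using assms(1) \<open>W = w # ws\<close> Cons by (intro star_trail_append) auto
      then have "star_trail G (set W) ([] @ {w, v} # ys)"
        using \<open>W = w # ws\<close> Cons by (simp add: insert_commute)
      then show ?thesis ..
    qed
  qed
qed

lemma nbhd_eqI:
  assumes "(x, a) \<in> parcs G" "(x, b) \<in> parcs G" "a \<noteq> b" "card (nbhd G x) \<le> 2"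
  shows "nbhd G x = {a, b}"
  using assms finite_nbhd[of x] by (intro card_seteq[symmetric]) auto

text \<open>Take a largest set \<open>S\<close> containing \<open>W\<close> that has a star trail.
  By maximality, triangles and connectivity, every vertex off \<open>U\<close> is in
  \<open>S\<close> or adjacent to it. An edge of the line graph is a pair of edges meeting in some
  \<open>u\<close>, and one of the two then touches \<open>S\<close>.\<close>

lemma dominating_trail_line_graph_aux:
  assumes conn: "connected_in (parcs G) (pverts G - U)"
    and W: "distinct W" "set W \<subseteq> pverts G - U" "set (walk_edges W) \<subseteq> edges G" "W \<noteq> []"
    and rest: "\<And>x. x \<in> pverts G - U - set W \<Longrightarrow> 3 \<le> card (nbhd G x) \<or> in_triangle G x"
    and U: "\<And>x. x \<in> U \<Longrightarrow> card (nbhd G x) \<le> 2 \<and> \<not> nbhd G x \<subseteq> U"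
  shows "\<exists>xs. dominating_trail (line_graph G) xs \<and> set xs \<subseteq> edges G"
proof -
  let ?P = "\<lambda>S. set W \<subseteq> S \<and> S \<subseteq> pverts G \<and> (\<exists>xs. star_trail G S xs)"
  have "?P (set W)" using W(2) star_trail_path[OF W(1,3)] by auto
  moreover have "\<forall>S. ?P S \<longrightarrow> card S < Suc (card (pverts G))"
    using card_mono[OF pair_finite_verts] by (simp add: less_Suc_eq_le)
  ultimately have "\<exists>S. ?P S \<and> (\<forall>T. ?P T \<longrightarrow> card T \<le> card S)"
    by (rule ex_has_greatest_nat)
  then obtain S where "?P S" and max: "\<And>T. ?P T \<Longrightarrow> card T \<le> card S"
    by metis
  then obtain xs where S: "set W \<subseteq> S" "S \<subseteq> pverts G" "star_trail G S xs" by blast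
  have finS: "finite S" using S(2) pair_finite_verts finite_subset by blast
  \<comment> \<open>Otherwise the closed trail through the clique at \<open>u\<close> could be
    spliced in at \<open>{s, u}\<close>, and \<open>S\<close> could be enlarged by
    \<open>u\<close>.\<close>
  have low: "card (nbhd G u) \<le> 2" if "u \<notin> S" "s \<in> S" "(u, s) \<in> parcs G" for u s
  proof (rule ccontr)
    assume "\<not> card (nbhd G u) \<le> 2"
    then have 3: "3 \<le> card (nbhd G u)" by simp
    have e: "{s, u} \<in> incident_edges G S" "{s, u} \<in> incident_edges G {u}"
      using that arc_sym unfolding incident_edges_def by auto
    obtain as bs where "xs = as @ {s, u} # bs"
      using e(1) S(3) split_list unfolding star_trail_def by metis
    moreover obtain cs where "star_trail G {u} ({s, u} # cs @ [{s, u}])"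
      using star_trail_closed[OF e(2) 3] by blast
    ultimately have "\<exists>ys. star_trail G (S \<union> {u}) ys"
      using star_trail_splice[of S as "{s, u}" bs "{u}" cs] S(3) that(1) by blast
    moreover have "u \<in> pverts G" using that(3) in_arcsD1 by blast
    ultimately have "card (S \<union> {u}) \<le> card S" using max[of "S \<union> {u}"] S by blast
    then show False using finS that(1) by simp
  qed
  \<comment> \<open>Such a \<open>z\<close> has degree at most two and is not on \<open>W\<close>,
    so \<open>rest\<close> puts it in a triangle, whose other corners must be its two
    neighbours.\<close>
  have other: "nbhd G z = {y, s} \<Longrightarrow> (y, s) \<in> parcs G"
    if z: "z \<in> pverts G - U" "z \<notin> S" "(z, s) \<in> parcs G" "s \<in> S" "(z, y) \<in> parcs G" "y \<noteq> s" for y z s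
  proof -
    assume nb: "nbhd G z = {y, s}"
    have "card (nbhd G z) \<le> 2" using low z by blast
    then have "in_triangle G z" using rest[of z] z S(1) by auto
    then obtain a b where ab: "a \<in> nbhd G z" "b \<in> nbhd G z" "(a, b) \<in> parcs G"
      unfolding in_triangle_def by auto
    then show "(y, s) \<in> parcs G"
      using nb arc_neq[OF ab(3)] arc_sym[OF ab(3)] by auto
  qed
  \<comment> \<open>The set is closed off \<open>U\<close>: a second neighbour \<open>y\<close> of a
    vertex \<open>z\<close> outside \<open>S\<close> is adjacent to the neighbour \<open>s\<close>
    of \<open>z\<close> in \<open>S\<close>, by \<open>other\<close>.\<close>
  let ?Z = "{z \<in> pverts G - U. z \<in> S \<or> (\<exists>s\<in>S. (z, s) \<in> parcs G)}"
  have "?Z = pverts G - U"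
  proof (rule connected_inD[OF conn])
    show "hd W \<in> ?Z" using W S(1) hd_in_set[OF W(4)] by blast
    fix z y assume z: "z \<in> ?Z" "y \<in> pverts G - U" "(z, y) \<in> parcs G"
    show "y \<in> ?Z"
    proof (cases "z \<in> S")
      case True
      then show ?thesis using z arc_sym by blast
    next
      case False
      then obtain s where s: "s \<in> S" "(z, s) \<in> parcs G" using z by blast
      have "(y, s) \<in> parcs G" if "y \<noteq> s"
        using other[of z s y] nbhd_eqI[of z y s] low[of z s] z s False that by blast
      then show ?thesis using s z by blast
    qed
  qed blast
  then have Z: "z \<in> S \<or> (\<exists>s\<in>S. (z, s) \<in> parcs G)" if "z \<in> pverts G - U" for z
    using that by blast
  have "p \<inter> set xs \<noteq> {}" if p_in: "p \<in> edges (line_graph G)" for p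
  proof (rule ccontr)
    assume no: "\<not> p \<inter> set xs \<noteq> {}"
    obtain e f u where p: "p = {e, f}" "e \<in> edges G" "f \<in> edges G" "e \<noteq> f" "u \<in> e" "u \<in> f"
      using p_in unfolding edges_line_graph by blast
    obtain a where a: "e = {u, a}" "(u, a) \<in> parcs G" using p edgesE_at by metis
    obtain b where b: "f = {u, b}" "(u, b) \<in> parcs G" using p edgesE_at by metis
    have "e \<notin> incident_edges G S" "f \<notin> incident_edges G S"
      using no p(1) S(3) unfolding star_trail_def by auto
    then have notS: "u \<notin> S" "a \<notin> S" "b \<notin> S" using p a b unfolding incident_edges_def by auto
    have ab: "a \<noteq> b" using a b p by auto
    have u: "u \<in> pverts G" using a in_arcsD1 by blast
    show False
    proof (cases "u \<in> U")
      case False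
      then obtain s where "s \<in> S" "(u, s) \<in> parcs G" using Z u notS by blast
      then show False
        using nbhd_eqI[OF a(2) b(2) ab low[of u s]] notS in_nbhd[of s G u] by auto
    next
      case True
      then have "nbhd G u = {a, b}" using nbhd_eqI[OF a(2) b(2) ab] U by blast
      \<comment> \<open>One of the two neighbours of \<open>u\<close> is off \<open>U\<close> and
        hence adjacent to some \<open>s\<close> in \<open>S\<close>. Its neighbours are then
        \<open>u\<close> and \<open>s\<close>, and the triangle makes \<open>s\<close> a neighbour
        of \<open>u\<close> too.\<close>
      then obtain y where y: "y \<notin> U" "(u, y) \<in> parcs G" "y \<notin> S"
        using U[OF True] notS by (metis in_nbhd insert_iff singletonD subsetI)
      then obtain s where s: "s \<in> S" "(y, s) \<in> parcs G" using Z[of y] in_arcsD2 by blast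
      have "u \<noteq> s" using s notS by blast
      then have "(u, s) \<in> parcs G"
        using other[of y s u] nbhd_eqI[of y u s] low[of y s] y s arc_sym in_arcsD2 by blast
      then have "s \<in> {a, b}" using \<open>nbhd G u = {a, b}\<close> in_nbhd[of s G u] by blast
      then show False using s notS by blast
    qed
  qed
  then have "dominating_trail (line_graph G) xs"
    using S(3) meeting_pairs_subset unfolding star_trail_def dominating_trail_def by blast
  moreover have "set xs \<subseteq> edges G"
    using S(3) unfolding star_trail_def incident_edges_def by blast
  ultimately show ?thesis by blast
qed

lemma dominating_trail_line_graph:
  assumes "connected_in (parcs G) (pverts G - U)" "pverts G - U \<noteq> {}"
    "distinct W" "set W \<subseteq> pverts G - U" "set (walk_edges W) \<subseteq> edges G"
    "\<And>x. x \<in> pverts G - U - set W \<Longrightarrow> 3 \<le> card (nbhd G x) \<or> in_triangle G x"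
    "\<And>x. x \<in> U \<Longrightarrow> card (nbhd G x) \<le> 2 \<and> \<not> nbhd G x \<subseteq> U"
  shows "\<exists>xs. dominating_trail (line_graph G) xs \<and> set xs \<subseteq> edges G"
proof (cases W)
  case Nil
  \<comment> \<open>The connectivity argument needs a nonempty start, so an empty path is replaced
    by a single vertex.\<close>
  obtain w where "w \<in> pverts G - U" using assms(2) by blast
  then show ?thesis
    using dominating_trail_line_graph_aux[OF assms(1), of "[w]"] assms(6,7) Nil by auto
next
  case Cons
  then show ?thesis using dominating_trail_line_graph_aux[OF assms(1,3,4,5)] assms(6,7) by blast
qed

end

section \<open>Thin vertices of a line graph\<close>

definition edges_within :: "'a pair_pre_digraph \<Rightarrow> 'a set \<Rightarrow> 'a set set" where
  "edges_within G S = {e \<in> edges G. e \<subseteq> S}"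

definition thin :: "'a pair_pre_digraph \<Rightarrow> 'a set" where
  "thin G = {x \<in> pverts G. card (nbhd G x) \<le> 2 \<and> \<not> in_triangle G x}"

lemma walk_edges_twiceE:
  assumes "p \<in> set (walk_edges (walk_edges xs))" "distinct xs"
  shows "\<exists>e f. p = {e, f} \<and> e \<in> set (walk_edges xs) \<and> f \<in> set (walk_edges xs) \<and> e \<noteq> f \<and> e \<inter> f \<noteq> {}"
  using assms
proof (induction xs rule: walk_edges.induct)
  case (1 x y zs)
  show ?case
  proof (cases zs)
    case (Cons z ws)
    show ?thesis
    proof (cases "p = {{x, y}, {y, z}}")
      case True
      have "{x, y} \<noteq> {y, z}" using 1(3) Cons by (auto simp: doubleton_eq_iff)
      then show ?thesis using True Cons by (intro exI[of _ "{x, y}"] exI[of _ "{y, z}"]) simp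
    next
      case False
      then have "p \<in> set (walk_edges (walk_edges (y # zs)))" using 1(2) Cons by simp
      then obtain e f where "p = {e, f}" "e \<in> set (walk_edges (y # zs))"
        "f \<in> set (walk_edges (y # zs))" "e \<noteq> f" "e \<inter> f \<noteq> {}"
        using 1 by auto
      then show ?thesis by (intro exI[of _ e] exI[of _ f]) simp
    qed
  qed (use 1 in simp)
qed simp_all

text \<open>The injection is carried along because \<open>iter_line_graph\<close> renames the
  vertices after each step.\<close>

locale labelled_line_graph = pair_graph G for G :: "'a pair_pre_digraph" +
  fixes \<phi> :: "'a set \<Rightarrow> 'b"
  assumes inj: "inj_on \<phi> (edges G)"
begin

abbreviation "L \<equiv> relabel \<phi> (line_graph G)"

lemma phi_eq_iff: "e \<in> edges G \<Longrightarrow> f \<in> edges G \<Longrightarrow> \<phi> e = \<phi> f \<longleftrightarrow> e = f"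
  using inj by (auto dest: inj_onD)

lemma pair_graph_L: "pair_graph L"
  by (intro pair_graph_relabel pair_graph_line_graph) (use inj pair_graph_axioms in simp_all)

lemma parcs_L_iff:
  assumes "e \<in> edges G" "f \<in> edges G"
  shows "(\<phi> e, \<phi> f) \<in> parcs L \<longleftrightarrow> e \<noteq> f \<and> e \<inter> f \<noteq> {}"
proof
  assume "(\<phi> e, \<phi> f) \<in> parcs L"
  then obtain e' f' where "\<phi> e = \<phi> e'" "\<phi> f = \<phi> f'" "e' \<in> edges G" "f' \<in> edges G"
    "e' \<noteq> f'" "e' \<inter> f' \<noteq> {}"
    unfolding parcs_relabel parcs_line_graph by blast
  then show "e \<noteq> f \<and> e \<inter> f \<noteq> {}" using phi_eq_iff assms by metis
next
  assume "e \<noteq> f \<and> e \<inter> f \<noteq> {}"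
  then have "(e, f) \<in> parcs (line_graph G)" using assms unfolding parcs_line_graph by blast
  then show "(\<phi> e, \<phi> f) \<in> parcs L" by (force simp: parcs_relabel)
qed

lemma edges_L: "edges L = {{\<phi> e, \<phi> f} | e f. e \<in> edges G \<and> f \<in> edges G \<and> e \<noteq> f \<and> e \<inter> f \<noteq> {}}"
proof (intro equalityI subsetI)
  fix p assume "p \<in> edges L"
  then obtain q where "q \<in> edges (line_graph G)" "p = \<phi> ` q"
    unfolding edges_relabel by blast
  moreover from this(1) obtain e f where
    "q = {e, f}" "e \<in> edges G" "f \<in> edges G" "e \<noteq> f" "e \<inter> f \<noteq> {}"
    unfolding edges_line_graph by blast
  ultimately show "p \<in> {{\<phi> e, \<phi> f} | e f. e \<in> edges G \<and> f \<in> edges G \<and> e \<noteq> f \<and> e \<inter> f \<noteq> {}}"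
    by blast
next
  fix p assume "p \<in> {{\<phi> e, \<phi> f} | e f. e \<in> edges G \<and> f \<in> edges G \<and> e \<noteq> f \<and> e \<inter> f \<noteq> {}}"
  then obtain e f where "p = \<phi> ` {e, f}" "{e, f} \<in> edges (line_graph G)"
    unfolding edges_line_graph by blast
  then show "p \<in> edges L" unfolding edges_relabel by blast
qed

lemma edge_nonempty: "e \<in> edges G \<Longrightarrow> \<exists>x. x \<in> e"
  by (elim edgesE) auto

lemma edge_subset_pverts: "e \<in> edges G \<Longrightarrow> e \<subseteq> pverts G"
  by (elim edgesE) auto

lemma pverts_L_diff: "pverts L - \<phi> ` edges_within G U = \<phi> ` (edges G - edges_within G U)"
  using inj_on_image_set_diff[OF inj, of "edges G" "edges_within G U"]
  by (auto simp: edges_within_def)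

text \<open>The endpoints off \<open>U\<close> of a closed set of edges form a closed set of
  vertices, hence are all of \<open>pverts G - U\<close>. Every edge not within \<open>U\<close> has
  an endpoint there and so belongs to the set.\<close>

lemma connected_in_L:
  assumes "connected_in (parcs G) (pverts G - U)"
  shows "connected_in (parcs L) (pverts L - \<phi> ` edges_within G U)"
  unfolding connected_in_def pverts_L_diff
proof (intro allI impI)
  fix S' assume S': "S' \<noteq> {}" "S' \<subseteq> \<phi> ` (edges G - edges_within G U)"
    and cl: "\<forall>x\<in>S'. \<forall>y\<in>\<phi> ` (edges G - edges_within G U). (x, y) \<in> parcs L \<longrightarrow> y \<in> S'"
  define F where "F = {e \<in> edges G - edges_within G U. \<phi> e \<in> S'}"
  have S'_eq: "S' = \<phi> ` F" using S'(2) unfolding F_def by blast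
  have clF: "f \<in> F" if "e \<in> F" "f \<in> edges G - edges_within G U" "x \<in> e" "x \<in> f" for e f x
  proof (cases "e = f")
    case False
    then have "(\<phi> e, \<phi> f) \<in> parcs L" using parcs_L_iff[of e f] that F_def by blast
    then show ?thesis using cl that F_def by blast
  qed (use that in simp)
  let ?S = "{x \<in> pverts G - U. \<exists>e\<in>F. x \<in> e}"
  have not_within: "\<exists>x\<in>pverts G - U. x \<in> e" if "e \<in> edges G - edges_within G U" for e
    using that edge_subset_pverts[of e] unfolding edges_within_def by blast
  obtain e where e: "e \<in> F" using S'(1) S'_eq by blast
  then obtain x where x: "x \<in> ?S" using not_within[of e] F_def by blast
  have "?S = pverts G - U"
  proof (rule connected_inD[OF assms x])
    fix x y assume xy: "x \<in> ?S" "y \<in> pverts G - U" "(x, y) \<in> parcs G"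
    then have "{x, y} \<in> edges G - edges_within G U" by (simp add: edges_within_def)
    then have "{x, y} \<in> F" using xy(1) clF[of _ "{x, y}" x] by blast
    then show "y \<in> ?S" using xy(2) by blast
  qed blast
  have "edges G - edges_within G U \<subseteq> F"
  proof
    fix f assume f: "f \<in> edges G - edges_within G U"
    then obtain x where "x \<in> pverts G - U" "x \<in> f" using not_within by blast
    moreover from this obtain e where "e \<in> F" "x \<in> e" using \<open>?S = pverts G - U\<close> by blast
    ultimately show "f \<in> F" using clF f by blast
  qed
  then show "S' = \<phi> ` (edges G - edges_within G U)" using S'_eq S'(2) by blast
qed

lemma nbhd_L: "e \<in> edges G \<Longrightarrow> nbhd L (\<phi> e) = \<phi> ` (incident_edges G e - {e})"
proof (intro equalityI subsetI)
  fix y assume e: "e \<in> edges G" and y: "y \<in> nbhd L (\<phi> e)"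
  then have "y \<in> pverts L" using pair_wf_digraph.in_arcsD2[of L] pair_graph_L
    unfolding pair_graph_def pair_digraph_def pair_fin_digraph_def by fastforce
  then obtain f where "f \<in> edges G" "y = \<phi> f" by auto
  then show "y \<in> \<phi> ` (incident_edges G e - {e})"
    using parcs_L_iff[of e f] e y unfolding incident_edges_def by auto
next
  fix y assume "e \<in> edges G" "y \<in> \<phi> ` (incident_edges G e - {e})"
  then show "y \<in> nbhd L (\<phi> e)"
    unfolding incident_edges_def using parcs_L_iff by auto
qed

text \<open>Each end contributes two edges and only \<open>e\<close> is counted twice: three edges
  touch \<open>e\<close>, itself included.\<close>

lemma card_nbhd_L:
  assumes "e \<in> edges G" "\<And>u. u \<in> e \<Longrightarrow> card (nbhd G u) = 2"
  shows "card (nbhd L (\<phi> e)) = 2"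
proof -
  obtain u v where uv: "e = {u, v}" "u \<noteq> v" using edgesE[OF assms(1)] by metis
  have "incident_edges G {u} \<inter> incident_edges G {v} = {e}"
    using assms(1) uv edges_eq_if_Int[of _ e u v] unfolding incident_edges_def by auto
  moreover have "incident_edges G e = incident_edges G {u} \<union> incident_edges G {v}"
    unfolding incident_edges_def uv by auto
  ultimately have "card (incident_edges G e) = 3"
    using card_Un_Int[of "incident_edges G {u}" "incident_edges G {v}"] assms(2) uv(1)
    by (simp add: finite_incident_edges card_incident_edges)
  moreover have "e \<in> incident_edges G e" using assms(1) uv unfolding incident_edges_def by auto
  ultimately have "card (incident_edges G e - {e}) = 2" by simp
  moreover have "inj_on \<phi> (incident_edges G e - {e})"
    using inj by (rule inj_on_subset) (auto simp: incident_edges_def)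
  ultimately show ?thesis using nbhd_L[OF assms(1)] by (simp add: card_image)
qed

lemma in_triangle_L:
  assumes "e \<in> edges G" "f \<in> edges G" "g \<in> edges G" "e \<noteq> f" "e \<noteq> g" "f \<noteq> g"
    "e \<inter> f \<noteq> {}" "e \<inter> g \<noteq> {}" "f \<inter> g \<noteq> {}"
  shows "in_triangle L (\<phi> e)"
proof -
  have "(\<phi> e, \<phi> f) \<in> parcs L" "(\<phi> e, \<phi> g) \<in> parcs L" "(\<phi> f, \<phi> g) \<in> parcs L"
    using assms by (simp_all only: parcs_L_iff simp_thms)
  then show ?thesis unfolding in_triangle_def by blast
qed

text \<open>If an end of \<open>e\<close> has degree at least three, then \<open>e\<close> and two
  further edges there form a triangle of \<open>L\<close>. If an end has degree at most two and lies
  in a triangle, then \<open>e\<close> is a side of it, and the three sides form a triangle of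
  \<open>L\<close>.\<close>

lemma thin_L: "thin L \<subseteq> \<phi> ` edges_within G (thin G)"
proof
  fix x assume x: "x \<in> thin L"
  then obtain e where e: "e \<in> edges G" "x = \<phi> e" unfolding thin_def by auto
  have nt: "\<not> in_triangle L (\<phi> e)" using x e unfolding thin_def by blast
  have "u \<in> thin G" if u: "u \<in> e" for u
  proof (rule ccontr)
    assume "u \<notin> thin G"
    obtain v where v: "e = {u, v}" "(u, v) \<in> parcs G" using edgesE_at[OF e(1) u] by metis
    have "card (nbhd G u) > 2 \<or> in_triangle G u"
      using \<open>u \<notin> thin G\<close> edge_subset_pverts[OF e(1)] u unfolding thin_def by auto
    moreover have low: "card (nbhd G u) \<le> 2"
    proof (rule ccontr)
      assume "\<not> card (nbhd G u) \<le> 2"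
      moreover have "card {a, v} \<le> 2" for a by (simp add: card_insert_if)
      ultimately have "\<not> nbhd G u \<subseteq> {a, v}" for a
        using card_mono[of "{a, v}" "nbhd G u"] by (meson finite.emptyI finite.insertI order_trans)
      then obtain a b where ab: "a \<in> nbhd G u" "a \<noteq> v" "b \<in> nbhd G u" "b \<noteq> a" "b \<noteq> v"
        by (metis insertCI subsetI)
      then have "in_triangle L (\<phi> e)"
        using e(1) v in_triangle_L[of e "{u, a}" "{u, b}"] by (auto simp: doubleton_eq_iff)
      then show False using nt by blast
    qed
    ultimately obtain a b where ab: "(u, a) \<in> parcs G" "(u, b) \<in> parcs G" "(a, b) \<in> parcs G"
      unfolding in_triangle_def by auto
    have neq: "a \<noteq> b" "u \<noteq> a" "u \<noteq> b" using ab arc_neq by auto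
    have tri: "in_triangle L (\<phi> {u, a})" if "(u, a) \<in> parcs G" "(u, b) \<in> parcs G" "(a, b) \<in> parcs G"
      "a \<noteq> b" "u \<noteq> a" "u \<noteq> b" for a b
      using that by (intro in_triangle_L[of _ "{u, b}" "{a, b}"]) (simp_all add: doubleton_eq_iff)
    have "v \<in> {a, b}"
      using nbhd_eqI[OF ab(1,2) neq(1) low] v in_nbhd[of v G u] by blast
    then have "in_triangle L (\<phi> e)"
      using tri[of a b] tri[of b a] ab neq arc_sym[OF ab(3)] v by auto
    then show False using nt by blast
  qed
  then show "x \<in> \<phi> ` edges_within G (thin G)" using e unfolding edges_within_def by blast
qed

text \<open>A connected set of edges inside a set of vertices of degree at most two spans a path, which
  has one vertex more than it has edges; it cannot close up because the graph is connected and has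
  other vertices.\<close>

lemma connected_edge_set:
  assumes F: "F \<subseteq> edges_within G Y" "F \<noteq> {}" "connected_in (parcs L) (\<phi> ` F)"
    and Y: "\<And>x. x \<in> Y \<Longrightarrow> card (nbhd G x) \<le> 2" "\<not> pverts G \<subseteq> Y"
    and conn: "connected_in (parcs G) (pverts G)"
  shows "connected_in (parcs G) (\<Union>F) \<and> card F < card (\<Union>F)"
proof
  have FE: "F \<subseteq> edges G" using F(1) unfolding edges_within_def by blast
  show "connected_in (parcs G) (\<Union>F)"
    unfolding connected_in_def
  proof (intro allI impI)
    fix S assume S: "S \<noteq> {}" "S \<subseteq> \<Union>F" "\<forall>x\<in>S. \<forall>y\<in>\<Union>F. (x, y) \<in> parcs G \<longrightarrow> y \<in> S"
    have sub: "e \<subseteq> S" if e: "e \<in> F" "x \<in> e" "x \<in> S" for e x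
    proof -
      have "e \<in> edges G" using e(1) FE by blast
      then obtain y where "e = {x, y}" "(x, y) \<in> parcs G" using edgesE_at e(2) by metis
      then show ?thesis using S(3) e by blast
    qed
    obtain x0 e0 where "x0 \<in> S" "x0 \<in> e0" "e0 \<in> F" using S(1,2) by blast
    have "\<phi> ` {e \<in> F. e \<subseteq> S} = \<phi> ` F"
    proof (rule connected_inD[OF F(3)])
      show "\<phi> e0 \<in> \<phi> ` {e \<in> F. e \<subseteq> S}" using sub \<open>x0 \<in> S\<close> \<open>x0 \<in> e0\<close> \<open>e0 \<in> F\<close> by blast
      fix p q assume p: "p \<in> \<phi> ` {e \<in> F. e \<subseteq> S}" and q: "q \<in> \<phi> ` F" and pq: "(p, q) \<in> parcs L"
      obtain e f where ef: "p = \<phi> e" "q = \<phi> f" "e \<in> F" "e \<subseteq> S" "f \<in> F" using p q by blast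
      then have "e \<inter> f \<noteq> {}" using parcs_L_iff[of e f] FE pq by blast
      then have "f \<subseteq> S" using sub ef by blast
      then show "q \<in> \<phi> ` {e \<in> F. e \<subseteq> S}" using ef by blast
    qed blast
    then have "{e \<in> F. e \<subseteq> S} = F"
      using inj_on_image_eq_iff[OF inj, of "{e \<in> F. e \<subseteq> S}" F] FE by blast
    then show "S = \<Union>F" using S(2) by blast
  qed
  have finF: "finite F" using FE finite_edges finite_subset by blast
  have UV: "\<Union>F \<subseteq> pverts G" using FE edge_subset_pverts by blast
  have UY: "\<Union>F \<subseteq> Y" using F(1) unfolding edges_within_def by blast
  have finU: "finite (\<Union>F)" using UV pair_finite_verts finite_subset by blast
  have inc: "{e \<in> F. x \<in> e} \<subseteq> incident_edges G {x}" for x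
    using FE unfolding incident_edges_def by blast
  have le2: "card {e \<in> F. x \<in> e} \<le> 2" if "x \<in> \<Union>F" for x
  proof -
    have "x \<in> Y" using UY that by blast
    then show ?thesis using card_mono[OF finite_incident_edges inc, of x] card_incident_edges[of x] Y(1)[of x] by simp
  qed
  \<comment> \<open>Connectivity of \<open>G\<close> and a vertex outside \<open>Y\<close> provide
    an edge that leaves \<open>\<Union>F\<close>. It uses up one of the at most two edges at
    \<open>x\<close>, which leaves at most one in \<open>F\<close>.\<close>
  have "\<exists>x\<in>\<Union>F. \<exists>y\<in>pverts G - \<Union>F. (x, y) \<in> parcs G"
  proof (rule ccontr)
    assume no: "\<not> ?thesis"
    obtain e0 where "e0 \<in> F" using F(2) by blast
    then obtain x0 where "x0 \<in> \<Union>F" using edge_nonempty FE by blast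
    then have "\<Union>F = pverts G" using connected_inD[OF conn _ UV] no by blast
    then show False using UY Y(2) by blast
  qed
  then obtain x y where xy: "x \<in> \<Union>F" "y \<notin> \<Union>F" "(x, y) \<in> parcs G" by blast
  have lt2: "card {e \<in> F. x \<in> e} < 2"
  proof -
    have "{x, y} \<in> incident_edges G {x} - {e \<in> F. x \<in> e}"
      using xy unfolding incident_edges_def by auto
    then have "{e \<in> F. x \<in> e} \<subset> incident_edges G {x}" using inc[of x] by blast
    then have "card {e \<in> F. x \<in> e} < card (incident_edges G {x})"
      by (rule psubset_card_mono[OF finite_incident_edges])
    then show ?thesis using card_incident_edges[of x] Y(1)[of x] xy(1) UY by auto
  qed
  \<comment> \<open>Incidences are counted twice: every edge of \<open>F\<close> has two ends, every
    vertex lies on at most two edges of \<open>F\<close>, and \<open>x\<close> on fewer.\<close>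
  have "2 * card F = (\<Sum>e\<in>F. card {x \<in> \<Union>F. x \<in> e})"
  proof -
    have "card {x \<in> \<Union>F. x \<in> e} = 2" if e: "e \<in> F" for e
    proof -
      have "{x \<in> \<Union>F. x \<in> e} = e" using e by blast
      moreover have "e \<in> edges G" using e FE by blast
      then obtain a b where "e = {a, b}" "a \<noteq> b" using edgesE by metis
      ultimately show ?thesis by simp
    qed
    then show ?thesis by (simp add: mult.commute)
  qed
  also have "\<dots> = (\<Sum>x\<in>\<Union>F. card {e \<in> F. x \<in> e})"
    using sum.swap_restrict[OF finF finU, of "\<lambda>_ _. 1::nat" "\<lambda>e x. x \<in> e"] by simp
  also have "\<dots> < (\<Sum>x\<in>\<Union>F. 2)"
    using finU le2 xy(1) lt2 by (intro sum_strict_mono_ex1) auto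
  finally show "card F < card (\<Union>F)" by simp
qed

end

section \<open>Iterating the line graph\<close>

text \<open>
  \<open>U\<close> collects the thin vertices of the short cycles, which the path \<open>W\<close> avoids. In \<open>j\<close> steps every
  connected set of at most \<open>j\<close> vertices disappears, and what is left of \<open>U\<close> consists of components with
  at most two vertices, so that each of them has a neighbour outside \<open>U\<close>.
\<close>

locale path_covered = pair_graph G for G :: "'a pair_pre_digraph" +
  fixes U :: "'a set" and W :: "'a list" and j :: nat
  assumes conn: "connected_in (parcs G) (pverts G)"
    and conn_diff: "connected_in (parcs G) (pverts G - U)"
    and U_subset: "U \<subseteq> pverts G"
    and card_nbhd_U: "x \<in> U \<Longrightarrow> card (nbhd G x) = 2"
    and U_closed: "\<lbrakk>x \<in> U; y \<in> thin G; (x, y) \<in> parcs G\<rbrakk> \<Longrightarrow> y \<in> U"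
    and proper: "\<not> pverts G \<subseteq> thin G \<union> U"
    and distinct_W: "distinct W"
    and W_subset: "set W \<subseteq> pverts G - U"
    and walk_edges_W: "set (walk_edges W) \<subseteq> edges G"
    and small: "\<lbrakk>C \<subseteq> U; C \<noteq> {}; connected_in (parcs G) C\<rbrakk> \<Longrightarrow> card C \<le> j + 2"
    and large: "\<lbrakk>C \<subseteq> thin G - U; connected_in (parcs G) C; j < card C\<rbrakk> \<Longrightarrow>
      C \<subseteq> set W \<and> edges_within G C \<subseteq> set (walk_edges W)"

lemma (in pair_graph) not_thin_edges:
  assumes "x \<in> pverts G" "x \<notin> thin G"
  shows "\<exists>a b. (x, a) \<in> parcs G \<and> (x, b) \<in> parcs G \<and> a \<noteq> b"
proof (cases "in_triangle G x")
  case True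
  then show ?thesis unfolding in_triangle_def using arc_neq by blast
next
  case False
  then have "2 < card (nbhd G x)" using assms unfolding thin_def by auto
  then have "nbhd G x \<noteq> {}" by auto
  then obtain a where a: "a \<in> nbhd G x" by blast
  have "nbhd G x \<noteq> {a}" using \<open>2 < card (nbhd G x)\<close> by auto
  then obtain b where "b \<in> nbhd G x" "b \<noteq> a" using a by blast
  then show ?thesis using a by auto
qed

text \<open>Both size bounds drop by one because a connected set of \<open>c\<close> vertices of
  \<open>L\<close> with low-degree ends comes from \<open>c\<close> edges that span more than
  \<open>c\<close> vertices (\<open>connected_edge_set\<close>). The edges of \<open>W\<close> form
  the new path.\<close>

lemma path_covered_line_graph:
  assumes "path_covered G U W (Suc j)" "inj_on \<phi> (edges G)"
  shows "path_covered (relabel \<phi> (line_graph G)) (\<phi> ` edges_within G U) (map \<phi> (walk_edges W)) j"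
proof -
  interpret path_covered G U W "Suc j" by fact
  interpret labelled_line_graph G \<phi>
    by (intro labelled_line_graph.intro labelled_line_graph_axioms.intro pair_graph_axioms assms(2))
  have sub_image: "\<exists>F\<subseteq>edges_within G Y. C = \<phi> ` F" if "C \<subseteq> \<phi> ` edges_within G Y" for C Y
    using that by (simp add: subset_image_iff)
  \<comment> \<open>By \<open>U_closed\<close> an edge between thin vertices cannot cross the border
    of \<open>U\<close>.\<close>
  have thin_U: "e \<inter> U = {}" if e: "e \<in> edges_within G (thin G)" "\<not> e \<subseteq> U" for e
  proof (rule ccontr)
    assume "e \<inter> U \<noteq> {}"
    then obtain x where x: "x \<in> e" "x \<in> U" by blast
    then obtain y where "e = {x, y}" "(x, y) \<in> parcs G"
      using edgesE_at e(1) unfolding edges_within_def by blast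
    then show False using U_closed[of x y] x e unfolding edges_within_def by blast
  qed
  have thin_L_U: "thin L - \<phi> ` edges_within G U \<subseteq> \<phi> ` edges_within G (thin G - U)"
  proof
    fix p assume p: "p \<in> thin L - \<phi> ` edges_within G U"
    then obtain e where e: "p = \<phi> e" "e \<in> edges_within G (thin G)" using thin_L by blast
    have "e \<notin> edges_within G U" using p e(1) by blast
    then have "\<not> e \<subseteq> U" using e(2) unfolding edges_within_def by blast
    then have "e \<inter> U = {}" using thin_U e(2) by blast
    then have "e \<in> edges_within G (thin G - U)" using e(2) unfolding edges_within_def by blast
    then show "p \<in> \<phi> ` edges_within G (thin G - U)" using e(1) by blast
  qed
  have "edges_within G {} = {}" using edge_nonempty unfolding edges_within_def by blast
  then have "connected_in (parcs L) (pverts L)"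
    using connected_in_L[of "{}"] conn by simp
  moreover have "\<phi> ` edges_within G U \<subseteq> pverts L"
    unfolding edges_within_def by auto
  moreover have "\<forall>p\<in>\<phi> ` edges_within G U. card (nbhd L p) = 2"
    using card_nbhd_L card_nbhd_U unfolding edges_within_def by blast
  moreover have "q \<in> \<phi> ` edges_within G U"
    if p: "p \<in> \<phi> ` edges_within G U" and q: "q \<in> thin L" and pq: "(p, q) \<in> parcs L" for p q
  proof (rule ccontr)
    assume "q \<notin> \<phi> ` edges_within G U"
    obtain e where e: "p = \<phi> e" "e \<in> edges G" "e \<subseteq> U" using p unfolding edges_within_def by blast
    have "q \<in> \<phi> ` edges_within G (thin G - U)"
      using q thin_L_U \<open>q \<notin> \<phi> ` edges_within G U\<close> by blast
    then obtain f where f: "q = \<phi> f" "f \<in> edges G" "f \<subseteq> thin G - U"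
      unfolding edges_within_def by blast
    show False using parcs_L_iff[of e f] pq e f by blast
  qed
  \<comment> \<open>An edge at a vertex outside \<open>thin G\<close> and \<open>U\<close> lies
    within neither of them, so it gives the required vertex of \<open>L\<close>.\<close>
  moreover have "\<not> pverts L \<subseteq> thin L \<union> \<phi> ` edges_within G U"
  proof
    assume sub: "pverts L \<subseteq> thin L \<union> \<phi> ` edges_within G U"
    obtain x where x: "x \<in> pverts G" "x \<notin> thin G" "x \<notin> U" using proper by blast
    then obtain y where "{x, y} \<in> edges G" using not_thin_edges by (metis edges_iff)
    moreover from this have "\<phi> {x, y} \<in> pverts L" unfolding pverts_relabel pverts_line_graph by (rule imageI)
    then have "\<phi> {x, y} \<in> \<phi> ` edges_within G (thin G) \<union> \<phi> ` edges_within G U"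
      using sub thin_L by blast
    ultimately have "{x, y} \<in> edges_within G (thin G) \<union> edges_within G U"
      using inj_on_image_mem_iff[OF inj, of "{x, y}" "edges_within G (thin G) \<union> edges_within G U"]
      unfolding image_Un[symmetric] edges_within_def by blast
    then show False using x unfolding edges_within_def by blast
  qed
  moreover have "distinct (map \<phi> (walk_edges W))"
    using distinct_walk_edges[OF distinct_W] inj_on_subset[OF inj walk_edges_W] by (simp add: distinct_map)
  moreover have "set (map \<phi> (walk_edges W)) \<subseteq> pverts L - \<phi> ` edges_within G U"
  proof -
    have "e \<notin> edges_within G U" if e: "e \<in> set (walk_edges W)" for e
    proof -
      have "e \<in> edges G" "e \<subseteq> pverts G - U" using walk_edges_subset[OF e] W_subset walk_edges_W e by blast+
      then show ?thesis using edge_nonempty[of e] unfolding edges_within_def by blast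
    qed
    then have "set (walk_edges W) \<subseteq> edges G - edges_within G U" using walk_edges_W by blast
    then show ?thesis unfolding pverts_L_diff set_map by (rule image_mono)
  qed
  moreover have "set (walk_edges (map \<phi> (walk_edges W))) \<subseteq> edges L"
  proof
    fix p assume "p \<in> set (walk_edges (map \<phi> (walk_edges W)))"
    then obtain q where q: "q \<in> set (walk_edges (walk_edges W))" "p = \<phi> ` q"
      unfolding walk_edges_map by auto
    obtain e f where "q = {e, f}" "e \<in> edges G" "f \<in> edges G" "e \<noteq> f" "e \<inter> f \<noteq> {}"
      using walk_edges_twiceE[OF q(1) distinct_W] walk_edges_W by blast
    then show "p \<in> edges L" unfolding edges_L q(2) by blast
  qed
  moreover have "card C \<le> j + 2" if C: "C \<subseteq> \<phi> ` edges_within G U" "C \<noteq> {}" "connected_in (parcs L) C" for C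
  proof -
    obtain F where F: "F \<subseteq> edges_within G U" "C = \<phi> ` F" using sub_image[OF C(1)] by blast
    have "connected_in (parcs G) (\<Union>F) \<and> card F < card (\<Union>F)"
      using F C card_nbhd_U proper conn by (intro connected_edge_set[of F U]) auto
    moreover have "\<Union>F \<subseteq> U" using F(1) unfolding edges_within_def by blast
    moreover have "\<Union>F \<noteq> {}" using F C(2) edge_nonempty unfolding edges_within_def by blast
    ultimately have "card F < Suc j + 2" using small[of "\<Union>F"] by (meson order_less_le_trans)
    moreover have "card C = card F"
      unfolding F(2) using F(1) inj_on_subset[OF inj, of F] by (intro card_image) (auto simp: edges_within_def)
    ultimately show ?thesis by simp
  qed
  moreover have "C \<subseteq> set (map \<phi> (walk_edges W)) \<and> edges_within L C \<subseteq> set (walk_edges (map \<phi> (walk_edges W)))"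
    if C: "C \<subseteq> thin L - \<phi> ` edges_within G U" "connected_in (parcs L) C" "j < card C" for C
  proof -
    have "C \<subseteq> \<phi> ` edges_within G (thin G - U)" using C(1) thin_L_U by blast
    then obtain F where F: "F \<subseteq> edges_within G (thin G - U)" "C = \<phi> ` F" using sub_image by blast
    have "F \<noteq> {}" using C(3) F(2) by auto
    have "connected_in (parcs G) (\<Union>F) \<and> card F < card (\<Union>F)"
      using F C(2) \<open>F \<noteq> {}\<close> proper conn
      by (intro connected_edge_set[of F "thin G - U"]) (auto simp: thin_def)
    moreover have "\<Union>F \<subseteq> thin G - U" using F(1) unfolding edges_within_def by blast
    moreover have "card C = card F"
      unfolding F(2) using F(1) inj_on_subset[OF inj, of F] by (intro card_image) (auto simp: edges_within_def)
    \<comment> \<open>The covered edges are the covered vertices of \<open>L\<close>. Two of them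
      that meet are consecutive on \<open>W\<close>, so the edge of \<open>L\<close> between them is
      covered too.\<close>
    ultimately have "edges_within G (\<Union>F) \<subseteq> set (walk_edges W)" using large[of "\<Union>F"] C(3) by simp
    moreover have "F \<subseteq> edges_within G (\<Union>F)" using F(1) unfolding edges_within_def by blast
    ultimately have FW: "F \<subseteq> set (walk_edges W)" by blast
    have "p \<in> set (walk_edges (map \<phi> (walk_edges W)))" if p: "p \<in> edges_within L C" for p
    proof -
      obtain e f where ef: "p = {\<phi> e, \<phi> f}" "e \<in> edges G" "f \<in> edges G" "e \<noteq> f" "e \<inter> f \<noteq> {}"
        using p unfolding edges_within_def edges_L by blast
      have "F \<subseteq> edges G" using F(1) unfolding edges_within_def by blast
      then have "e \<in> F" "f \<in> F"
        using p ef(1-3) inj_on_image_mem_iff[OF inj] unfolding edges_within_def F(2) by blast+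
      then have "{e, f} \<in> set (walk_edges (walk_edges W))"
        using FW distinct_W ef by (intro walk_edges_walk_edges) auto
      then have "\<phi> ` {e, f} \<in> set (walk_edges (map \<phi> (walk_edges W)))"
        unfolding walk_edges_map set_map by (rule imageI)
      then show ?thesis using ef(1) by simp
    qed
    then show ?thesis using FW F(2) by auto
  qed
  ultimately show ?thesis
    using connected_in_L[OF conn_diff] pair_graph_L
    by (intro path_covered.intro path_covered_axioms.intro) (assumption | blast)+
qed

text \<open>For \<open>j = 0\<close> the condition \<open>large\<close> applies to singletons and
  puts every thin vertex off \<open>U\<close> on \<open>W\<close>. A vertex of \<open>U\<close> with
  both neighbours in \<open>U\<close> would give a connected set of three vertices, against
  \<open>small\<close>.\<close>

lemma path_covered_dominating_trail:
  assumes "path_covered G U W 0"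
  shows "\<exists>xs. dominating_trail (line_graph G) xs \<and> set xs \<subseteq> edges G"
proof -
  interpret path_covered G U W 0 by fact
  show ?thesis
  proof (rule dominating_trail_line_graph[OF conn_diff _ distinct_W W_subset walk_edges_W])
    show "pverts G - U \<noteq> {}" using proper by blast
    show "3 \<le> card (nbhd G x) \<or> in_triangle G x" if x: "x \<in> pverts G - U - set W" for x
    proof (rule ccontr)
      assume "\<not> ?thesis"
      then have "x \<in> thin G - U" using x unfolding thin_def by auto
      moreover have "connected_in (parcs G) {x}" unfolding connected_in_def by blast
      ultimately show False using large[of "{x}"] x by simp
    qed
    show "card (nbhd G x) \<le> 2 \<and> \<not> nbhd G x \<subseteq> U" if x: "x \<in> U" for x
    proof -
      obtain y z where yz: "nbhd G x = {y, z}" "y \<noteq> z" using card_nbhd_U[OF x] by (auto simp: card_2_iff)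
      have arcs: "(x, y) \<in> parcs G" "(x, z) \<in> parcs G" using yz in_nbhd[of _ G x] by auto
      have "\<not> nbhd G x \<subseteq> U"
      proof
        assume "nbhd G x \<subseteq> U"
        moreover have "connected_in (parcs G) {x, y, z}"
          unfolding connected_in_def
        proof (intro allI impI)
          fix S assume S: "S \<noteq> {}" "S \<subseteq> {x, y, z}" "\<forall>a\<in>S. \<forall>b\<in>{x, y, z}. (a, b) \<in> parcs G \<longrightarrow> b \<in> S"
          have "x \<in> S" using S arcs arc_sym by blast
          then show "S = {x, y, z}" using S arcs by blast
        qed
        ultimately have "card {x, y, z} \<le> 2" using small[of "{x, y, z}"] yz(1) x by simp
        then show False using yz(2) arcs arc_neq by auto
      qed
      then show ?thesis using card_nbhd_U[OF x] by simp
    qed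
  qed
qed

text \<open>This ensures that the later iterates are defined and that the line graph taken last has
  a vertex.\<close>

lemma (in path_covered) edges_nonempty: "edges G \<noteq> {}" "edges (line_graph G) \<noteq> {}"
proof -
  obtain x where "x \<in> pverts G" "x \<notin> thin G"
    using proper by blast
  then obtain a b where ab: "(x, a) \<in> parcs G" "(x, b) \<in> parcs G" "a \<noteq> b"
    using not_thin_edges by blast
  then have "{x, a} \<in> edges G" "{x, b} \<in> edges G" "{x, a} \<noteq> {x, b}" "{x, a} \<inter> {x, b} \<noteq> {}"
    by (auto simp: doubleton_eq_iff)
  then show "edges G \<noteq> {}" "edges (line_graph G) \<noteq> {}" unfolding edges_line_graph by blast+
qed

text \<open>After \<open>j\<close> steps the parameter is zero. One further line graph has a
  dominating trail, and the next one is traceable.\<close>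

lemma path_covered_iter_line_graph:
  assumes "pair_graph G" "path_covered (iter_line_graph 0 G) U W j"
  shows "ham_path_index G \<le> enat (j + 2)"
proof -
  have pg: "pair_graph (iter_line_graph i G)" for i
    by (rule pair_graph_iter_line_graph[OF assms(1)])
  have cov: "\<exists>U W. path_covered (iter_line_graph i G) U W (j - i)" if "i \<le> j" for i
    using that
  proof (induction i)
    case 0
    then show ?case using assms(2) by auto
  next
    case (Suc i)
    then obtain U W where "path_covered (iter_line_graph i G) U W (Suc (j - Suc i))"
      by (auto simp: Suc_diff_Suc)
    then show ?case
      using path_covered_line_graph[OF _ inj_on_edge_vertex] by fastforce
  qed
  let ?K = "iter_line_graph j G"
  let ?X = "iter_line_graph (Suc j) G"
  obtain U W where K: "path_covered ?K U W 0" using cov[of j] by auto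
  obtain xs where xs: "dominating_trail (line_graph ?K) xs" "set xs \<subseteq> edges ?K"
    using path_covered_dominating_trail[OF K] by blast
  have "dominating_trail ?X (map edge_vertex xs)"
    using dominating_trail_relabel[OF pair_graph_line_graph[OF pg[of j]] xs(1), of edge_vertex]
      xs(2) inj_on_edge_vertex[of ?K] by simp
  moreover have edges_X: "edges ?X \<noteq> {}"
    using path_covered.edges_nonempty[OF K] by (simp add: edges_relabel)
  ultimately have "traceable (line_graph ?X)"
    using traceable_line_graph_if_dominating_trail[OF pg] by blast
  then have "traceable (iter_line_graph (j + 2) G)"
    using traceable_relabel[of "line_graph ?X" edge_vertex] inj_on_edge_vertex[of ?X] by simp
  moreover have "edges (iter_line_graph i G) \<noteq> {}" if "i < j + 2" for i
  proof (cases "i = Suc j")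
    case False
    then have "i \<le> j" using that by simp
    then show ?thesis using cov path_covered.edges_nonempty(1) by metis
  qed (use edges_X in simp)
  ultimately show ?thesis unfolding ham_path_index_def by (intro Inf_lower) blast
qed

section \<open>Paths on thin components\<close>

definition component :: "'a rel \<Rightarrow> 'a set \<Rightarrow> 'a set \<Rightarrow> bool" where
  "component E D C \<longleftrightarrow> C \<subseteq> D \<and> C \<noteq> {} \<and> connected_in E C \<and>
     (\<forall>x\<in>C. \<forall>y\<in>D. (x, y) \<in> E \<longrightarrow> y \<in> C)"

lemma connected_in_subset_component:
  assumes "component E D K" "connected_in E C" "C \<subseteq> D" "x \<in> C" "x \<in> K"
  shows "C \<subseteq> K"
proof -
  have "C \<inter> K = C"
    using assms unfolding component_def by (intro connected_inD[OF assms(2), of x]) blast+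
  then show ?thesis by blast
qed

lemma component_eq:
  assumes "component E D C" "component E D K" "x \<in> C" "x \<in> K"
  shows "C = K"
  using connected_in_subset_component[OF assms(1), of K x] connected_in_subset_component[OF assms(2), of C x]
    assms unfolding component_def by blast

lemma ex_component:
  assumes "sym E" "x \<in> D"
  shows "\<exists>C. component E D C \<and> x \<in> C"
proof -
  let ?R = "E \<inter> D \<times> D"
  let ?C = "{y. (x, y) \<in> ?R\<^sup>*}"
  have "sym ?R" using assms(1) unfolding sym_def by blast
  then have symR: "sym (?R\<^sup>*)" by (rule sym_rtrancl)
  have D: "y \<in> D" if "(x, y) \<in> ?R\<^sup>*" for y
    using that assms(2) by (induction rule: rtrancl_induct) blast+
  have "connected_in E ?C"
    unfolding connected_in_def
  proof (intro allI impI)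
    fix S assume S: "S \<noteq> {}" "S \<subseteq> ?C" "\<forall>x\<in>S. \<forall>y\<in>?C. (x, y) \<in> E \<longrightarrow> y \<in> S"
    then obtain s where s: "s \<in> S" by blast
    have "y \<in> S" if "(s, y) \<in> ?R\<^sup>*" for y
      using that
    proof (induction rule: rtrancl_induct)
      case (step y z)
      have "(x, y) \<in> ?R\<^sup>*" using step.IH S(2) by blast
      then have "(x, z) \<in> ?R\<^sup>*" using step.hyps(2) by (rule rtrancl_into_rtrancl)
      then show ?case using step S(3) by blast
    qed (rule s)
    \<comment> \<open>Symmetry leads from \<open>s\<close> back to \<open>x\<close>, and from there
      to every vertex of the class.\<close>
    moreover have "(s, y) \<in> ?R\<^sup>*" if y: "(x, y) \<in> ?R\<^sup>*" for y
    proof -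
      have "(x, s) \<in> ?R\<^sup>*" using s S(2) by blast
      then have "(s, x) \<in> ?R\<^sup>*" using symR unfolding sym_def by blast
      then show ?thesis using y by (rule rtrancl_trans)
    qed
    ultimately show "S = ?C" using S(2) by blast
  qed
  moreover have "y \<in> ?C" if "z \<in> ?C" "y \<in> D" "(z, y) \<in> E" for y z
    using that D[of z] by (auto intro: rtrancl_into_rtrancl)
  ultimately have "component E D ?C"
    unfolding component_def using D by blast
  then show ?thesis by blast
qed

section \<open>Paths through vertices of degree at most two\<close>

context pair_graph begin

definition path_in :: "'a set \<Rightarrow> 'a list \<Rightarrow> bool" where
  "path_in A p \<longleftrightarrow> distinct p \<and> set p \<subseteq> A \<and> set (walk_edges p) \<subseteq> edges G"

lemma path_in_rev: "path_in A (rev p) \<longleftrightarrow> path_in A p"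
  unfolding path_in_def by (simp add: walk_edges_rev)

lemma path_arcs:
  assumes "set (walk_edges (as @ x # bs)) \<subseteq> edges G"
  shows "as \<noteq> [] \<Longrightarrow> (x, last as) \<in> parcs G" "bs \<noteq> [] \<Longrightarrow> (x, hd bs) \<in> parcs G"
proof -
  show "(x, last as) \<in> parcs G" if "as \<noteq> []"
  proof -
    obtain cs c where "as = cs @ [c]" using \<open>as \<noteq> []\<close> by (metis append_butlast_last_id)
    then have "{c, x} \<in> set (walk_edges (as @ x # bs))"
      using walk_edges_append_subset[of "c # x # bs" cs] by auto
    then show ?thesis using assms \<open>as = cs @ [c]\<close> arc_sym by auto
  qed
  show "(x, hd bs) \<in> parcs G" if "bs \<noteq> []"
  proof -
    obtain c cs where "bs = c # cs" using \<open>bs \<noteq> []\<close> by (cases bs) auto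
    then have "{x, c} \<in> set (walk_edges (as @ x # bs))"
      using walk_edges_append_subset[of "x # c # cs" as] by auto
    then show ?thesis using assms \<open>bs = c # cs\<close> by auto
  qed
qed

lemma path_append_edge:
  assumes "path_in A p" "p \<noteq> []" "y \<in> A" "y \<notin> set p" "(last p, y) \<in> parcs G"
  shows "path_in A (p @ [y])"
proof -
  obtain ps z where "p = ps @ [z]" using assms(2) by (metis append_butlast_last_id)
  then have "walk_edges (p @ [y]) = walk_edges p @ [{last p, y}]"
    using walk_edges_append[of ps z "[y]"] by simp
  then show ?thesis using assms unfolding path_in_def by auto
qed

text \<open>A longest path spans: an edge leaving it from an end, possibly after reversal, would
  extend it, and an inner vertex already has two neighbours on the path.\<close>

lemma ex_spanning_path:
  assumes A: "A \<subseteq> pverts G" "A \<noteq> {}" "connected_in (parcs G) A"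
    and deg: "\<And>x. x \<in> A \<Longrightarrow> card (nbhd G x) \<le> 2"
  shows "\<exists>p. path_in A p \<and> set p = A"
proof -
  let ?P = "\<lambda>p. p \<noteq> [] \<and> path_in A p"
  obtain a where "a \<in> A" using A(2) by blast
  then have "?P [a]" unfolding path_in_def by simp
  moreover have "\<forall>p. ?P p \<longrightarrow> length p < Suc (card A)"
    unfolding path_in_def
    using card_mono[OF finite_subset[OF A(1) pair_finite_verts]] distinct_card by (metis less_Suc_eq_le)
  ultimately have "\<exists>p. ?P p \<and> (\<forall>r. ?P r \<longrightarrow> length r \<le> length p)"
    by (rule ex_has_greatest_nat)
  then obtain p where p: "?P p" and max: "\<And>r. ?P r \<Longrightarrow> length r \<le> length p" by metis
  have "set p = A"
  proof (rule connected_inD[OF A(3)])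
    show "hd p \<in> set p" using p by simp
    show "set p \<subseteq> A" using p unfolding path_in_def by blast
    fix x y assume x: "x \<in> set p" and y: "y \<in> A" "(x, y) \<in> parcs G"
    show "y \<in> set p"
    proof (rule ccontr)
      assume ny: "y \<notin> set p"
      obtain as bs where split: "p = as @ x # bs" using x split_list by metis
      have "bs \<noteq> []"
      proof
        assume "bs = []"
        then have "?P (p @ [y])" using path_append_edge[of A p y] p ny y split by simp
        from max[OF this] show False by simp
      qed
      moreover have "as \<noteq> []"
      proof
        assume "as = []"
        then have "last (rev p) = x" using split by simp
        moreover have "path_in A (rev p)" using p path_in_rev by blast
        ultimately have "path_in A (rev p @ [y])"
          using path_append_edge[of A "rev p" y] p ny y by simp
        then have "?P (rev p @ [y])" by simp
        from max[OF this] show False by simp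
      qed
      ultimately have "(x, last as) \<in> parcs G" "(x, hd bs) \<in> parcs G" "last as \<noteq> hd bs"
        "y \<noteq> last as" "y \<noteq> hd bs"
        using path_arcs[of as x bs] p ny unfolding split path_in_def
        by (auto dest: last_in_set hd_in_set)
      moreover from this(1-3) have "nbhd G x = {last as, hd bs}"
        using deg[of x] x p unfolding path_in_def by (intro nbhd_eqI) auto
      ultimately show False using y(2) in_nbhd[of y G x] by blast
    qed
  qed
  then show ?thesis using p by blast
qed

lemma path_interior_nbhd:
  assumes "path_in A (as @ x # bs)" "as \<noteq> []" "bs \<noteq> []" "card (nbhd G x) \<le> 2"
  shows "nbhd G x = {last as, hd bs}"
proof (rule nbhd_eqI)
  show "(x, last as) \<in> parcs G" "(x, hd bs) \<in> parcs G"
    using path_arcs[of as x bs] assms unfolding path_in_def by blast+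
  have "last as \<in> set as" "hd bs \<in> set bs" using assms(2,3) by simp_all
  then show "last as \<noteq> hd bs" using assms(1) unfolding path_in_def by auto
qed (rule assms(4))

lemma spanning_path_ends:
  assumes p: "path_in C p" "set p = C" and deg: "\<And>x. x \<in> C \<Longrightarrow> card (nbhd G x) \<le> 2"
    and z: "z \<in> C" "(z, y) \<in> parcs G" "y \<notin> C"
  shows "z = hd p \<or> z = last p"
proof (rule ccontr)
  assume no: "\<not> ?thesis"
  obtain as bs where split: "p = as @ z # bs" using z(1) p(2) split_list by metis
  then have ne: "as \<noteq> []" "bs \<noteq> []" using no by auto
  then have "nbhd G z = {last as, hd bs}"
    using path_interior_nbhd[of C as z bs] p(1) deg[OF z(1)] split by simp
  moreover have "last as \<in> C" "hd bs \<in> C" using p(2) split ne by auto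
  ultimately show False using z by (metis empty_iff in_nbhd insert_iff)
qed

text \<open>Inner vertices have both neighbours next to them on the path, so a chord could only join
  the two ends. It would close the path to a cycle and leave no room for the edge from
  \<open>z\<close> to \<open>w\<close>.\<close>

lemma edges_within_spanning_path:
  assumes p: "path_in C p" "set p = C" and deg: "\<And>x. x \<in> C \<Longrightarrow> card (nbhd G x) \<le> 2"
    and z: "z \<in> C" "(z, w) \<in> parcs G" "w \<notin> C"
  shows "edges_within G C \<subseteq> set (walk_edges p)"
proof -
  have main: "{x, y} \<in> set (walk_edges p)" if split: "p = as @ x # bs @ y # cs" and xy: "(x, y) \<in> parcs G"
    for x y as bs cs
  proof (cases "bs = []")
    case True
    then show ?thesis
      using split walk_edges_append_subset[of "x # y # cs" as] by auto
  next
    case bs: False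
    have dist: "distinct p" using p(1) unfolding path_in_def by blast
    have C: "x \<in> C" "y \<in> C" "hd bs \<in> C" "last bs \<in> C" using p(2) split bs by auto
    have mem: "hd bs \<in> set bs" "last bs \<in> set bs" using bs by auto
    have "as = []"
    proof (rule ccontr)
      assume as: "as \<noteq> []"
      then have "nbhd G x = {last as, hd bs}"
        using path_interior_nbhd[of C as x "bs @ y # cs"] p(1) deg[OF C(1)] split bs by simp
      moreover have "last as \<in> set as" using as by simp
      ultimately show False using xy dist mem in_nbhd[of y G x] unfolding split by auto
    qed
    moreover have "cs = []"
    proof (rule ccontr)
      assume cs: "cs \<noteq> []"
      then have "nbhd G y = {last bs, hd cs}"
        using path_interior_nbhd[of C "as @ x # bs" y cs] p(1) deg[OF C(2)] split bs by simp
      moreover have "hd cs \<in> set cs" using cs by simp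
      ultimately show False using arc_sym[OF xy] dist mem in_nbhd[of x G y] unfolding split by auto
    qed
    ultimately have p_eq: "p = x # bs @ [y]" using split by simp
    have walk: "set (walk_edges p) \<subseteq> edges G" using p(1) unfolding path_in_def by blast
    have "(x, hd bs) \<in> parcs G" using path_arcs(2)[of "[]" x "bs @ [y]"] walk p_eq bs by simp
    then have "nbhd G x = {hd bs, y}"
      using nbhd_eqI[of x "hd bs" y] xy deg[OF C(1)] dist mem p_eq by auto
    moreover have "(y, last bs) \<in> parcs G" using path_arcs(1)[of "x # bs" y "[]"] walk p_eq bs by simp
    then have "nbhd G y = {last bs, x}"
      using nbhd_eqI[of y "last bs" x] arc_sym[OF xy] deg[OF C(2)] dist mem p_eq by auto
    moreover have "z = x \<or> z = y" using spanning_path_ends[OF p deg z] p_eq by simp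
    ultimately have "w \<in> C" using C z(2) by (metis empty_iff in_nbhd insert_iff)
    then show ?thesis using z(3) by blast
  qed
  show ?thesis
  proof
    fix e assume "e \<in> edges_within G C"
    then obtain x y where e: "e = {x, y}" "(x, y) \<in> parcs G" "x \<noteq> y" "x \<in> set p" "y \<in> set p"
      unfolding edges_within_def using p(2) by (blast elim: edgesE)
    obtain as bs where split: "p = as @ x # bs" using e(4) split_list by metis
    then consider "y \<in> set as" | "y \<in> set bs" using e(3,5) by auto
    then show "e \<in> set (walk_edges p)"
    proof cases
      case 1
      then obtain cs ds where "as = cs @ y # ds" using split_list by metis
      then show ?thesis using main[of cs y ds x bs] split e(1) arc_sym[OF e(2)] by (simp add: insert_commute)
    next
      case 2
      then obtain cs ds where "bs = cs @ y # ds" using split_list by metis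
      then show ?thesis using main[of as x cs y ds] split e(1,2) by simp
    qed
  qed
qed

text \<open>Together with \<open>v\<close> the path closes to a cycle, and its vertices have no
  edges besides those of the cycle.\<close>

lemma closed_path_nbhd:
  assumes p: "path_in C p" "set p = C" and deg: "\<And>x. x \<in> C \<Longrightarrow> card (nbhd G x) \<le> 2"
    and v: "v \<notin> C" "(hd p, v) \<in> parcs G" "(last p, v) \<in> parcs G" "hd p \<noteq> last p"
    and u: "u \<in> C"
  shows "nbhd G u \<subseteq> insert v C \<and> card (nbhd G u) = 2"
proof -
  obtain as bs where split: "p = as @ u # bs" using u p(2) split_list by metis
  \<comment> \<open>\<open>a\<close> and \<open>b\<close> are the cyclic neighbours of
    \<open>u\<close>; \<open>v\<close> replaces the missing one at an end of the path.\<close>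
  define a where "a = (if as = [] then v else last as)"
  define b where "b = (if bs = [] then v else hd bs)"
  have dist: "distinct p" and walk: "set (walk_edges p) \<subseteq> edges G" using p(1) unfolding path_in_def by blast+
  have arcs: "(u, a) \<in> parcs G" "(u, b) \<in> parcs G"
    unfolding a_def b_def using path_arcs[of as u bs] walk split v(2,3) by auto
  have "as = [] \<Longrightarrow> bs \<noteq> []" using v(4) split by auto
  moreover have "set as \<inter> set bs = {}" using dist split by simp
  then have "last as \<noteq> hd bs" if "as \<noteq> []" "bs \<noteq> []"
    using that last_in_set hd_in_set by (metis disjoint_iff)
  moreover have "as \<noteq> [] \<Longrightarrow> last as \<in> C" "bs \<noteq> [] \<Longrightarrow> hd bs \<in> C" using split p(2) by auto
  ultimately have "a \<noteq> b"
    unfolding a_def b_def using v(1) by auto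
  then have "nbhd G u = {a, b}" using arcs deg[OF u] by (intro nbhd_eqI)
  moreover have "a \<in> insert v C" "b \<in> insert v C"
    unfolding a_def b_def using p(2) split by auto
  ultimately show ?thesis using \<open>a \<noteq> b\<close> by auto
qed

lemma ex_connecting_path:
  assumes conn: "connected_in (parcs G) X" and A: "A \<subseteq> X" "A \<noteq> {}" and B: "B \<subseteq> X" "B \<noteq> {}"
    and disj: "A \<inter> B = {}"
  shows "\<exists>a r b. a \<in> A \<and> b \<in> B \<and> path_in X (a # r @ [b]) \<and> set r \<inter> (A \<union> B) = {}"
proof -
  \<comment> \<open>The paths start in \<open>A\<close> and do not return to it. When the search
    reaches a vertex of \<open>A\<close>, it restarts there with a one-vertex path.\<close>
  let ?P = "\<lambda>y r. path_in X r \<and> r \<noteq> [] \<and> hd r \<in> A \<and> last r = y \<and> set (tl r) \<inter> A = {}"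
  let ?S = "{y \<in> X. \<exists>r. ?P y r}"
  have single: "?P x [x]" if "x \<in> A" for x
    using that A(1) unfolding path_in_def by auto
  obtain a0 where a0: "a0 \<in> A" using A(2) by blast
  have "?S = X"
  proof (rule connected_inD[OF conn])
    show "a0 \<in> ?S" using single[OF a0] a0 A(1) by blast
    fix x y assume x: "x \<in> ?S" and y: "y \<in> X" "(x, y) \<in> parcs G"
    obtain r where r: "?P x r" using x by blast
    show "y \<in> ?S"
    proof (cases "y \<in> A")
      case True
      then show ?thesis using single[OF True] y by blast
    next
      case False
      show ?thesis
      proof (cases "y \<in> set r")
        case True
        then obtain as bs where split: "r = as @ y # bs" using split_list by metis
        have "as \<noteq> []" using r False split by auto
        moreover have "path_in X (as @ [y])"
          using r walk_edges_append[of as y bs] unfolding split path_in_def by auto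
        ultimately have "?P y (as @ [y])" using r unfolding split by auto
        then show ?thesis using y by blast
      next
        case F: False
        have "path_in X (r @ [y])" using path_append_edge[of X r y] r y F by blast
        then have "?P y (r @ [y])" using r False by auto
        then show ?thesis using y by blast
      qed
    qed
  qed blast
  obtain b0 where b0: "b0 \<in> B" using B(2) by blast
  then obtain r where r: "?P b0 r" using \<open>?S = X\<close> B(1) by blast
  have "\<exists>x\<in>set r. x \<in> B" using r b0 last_in_set by blast
  \<comment> \<open>Cutting at the first vertex of \<open>B\<close> keeps the inner part off
    \<open>B\<close>.\<close>
  then obtain as b bs where split: "r = as @ b # bs" "b \<in> B" "\<forall>x\<in>set as. x \<notin> B"
    using split_list_first_prop[of r "\<lambda>x. x \<in> B"] by blast
  have "as \<noteq> []" using r disj split by auto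
  then obtain a cs where as: "as = a # cs" by (cases as) auto
  have "path_in X (a # cs @ [b])"
    using r walk_edges_append[of as b bs] as unfolding split path_in_def by auto
  moreover have "a \<in> A" "set cs \<inter> (A \<union> B) = {}" using r split as by auto
  ultimately show ?thesis using split(2) by blast
qed

text \<open>A connecting path leaves \<open>A\<close> and enters \<open>B\<close> along edges to
  outside vertices. These edges are attached at ends of \<open>p\<close> and \<open>q\<close>, so
  after reversing \<open>p\<close> or \<open>q\<close> if necessary the three paths can be
  concatenated.\<close>

lemma ex_path_through_two:
  assumes conn: "connected_in (parcs G) X" and sub: "A \<subseteq> X" "B \<subseteq> X" and disj: "A \<inter> B = {}"
    and ne: "A \<noteq> {}" "B \<noteq> {}"
    and p: "path_in A p" "set p = A" and q: "path_in B q" "set q = B"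
    and deg: "\<And>x. x \<in> A \<union> B \<Longrightarrow> card (nbhd G x) \<le> 2"
    and no_arc: "\<And>x y. x \<in> A \<Longrightarrow> y \<in> B \<Longrightarrow> (x, y) \<notin> parcs G"
  shows "\<exists>W. path_in X W \<and> A \<union> B \<subseteq> set W \<and>
    set (walk_edges p) \<union> set (walk_edges q) \<subseteq> set (walk_edges W)"
proof -
  obtain a r b where r: "a \<in> A" "b \<in> B" "path_in X (a # r @ [b])" "set r \<inter> (A \<union> B) = {}"
    using ex_connecting_path[OF conn sub(1) ne(1) sub(2) ne(2) disj] by blast
  have walk_r: "set (walk_edges (a # r @ [b])) \<subseteq> edges G" using r(3) unfolding path_in_def by blast
  have "(a, hd (r @ [b])) \<in> parcs G" using path_arcs(2)[of "[]" a "r @ [b]"] walk_r by simp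
  moreover have "hd (r @ [b]) \<notin> A" using r disj by (cases r) auto
  ultimately have "a = hd p \<or> a = last p" using spanning_path_ends[OF p, of a] deg r(1) by blast
  then obtain p1 where p1: "path_in A p1" "set p1 = A" "last p1 = a" "set (walk_edges p1) = set (walk_edges p)"
    using p path_in_rev[of A p] by (metis last_rev set_rev walk_edges_rev)
  have "(b, last (a # r)) \<in> parcs G" using path_arcs(1)[of "a # r" b "[]"] walk_r by simp
  moreover have "last (a # r) \<notin> B"
  proof (cases "r = []")
    case False
    then have "last r \<in> set r" by simp
    then have "last r \<notin> B" using r(4) by blast
    then show ?thesis using False by simp
  qed (use r(1) disj in auto)
  ultimately have "b = hd q \<or> b = last q" using spanning_path_ends[OF q, of b] deg r(2) by blast
  then obtain q1 where q1: "path_in B q1" "set q1 = B" "hd q1 = b" "set (walk_edges q1) = set (walk_edges q)"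
    using q path_in_rev[of B q] by (metis hd_rev set_rev walk_edges_rev)
  obtain ps where ps: "p1 = ps @ [a]" using p1(2,3) ne(1) by (metis append_butlast_last_id set_empty)
  obtain qs where qs: "q1 = b # qs" using q1(2,3) ne(2) by (metis list.collapse set_empty)
  let ?W = "ps @ a # r @ b # qs"
  have we: "walk_edges ?W = walk_edges p1 @ walk_edges (a # r @ [b]) @ walk_edges q1"
    using walk_edges_append[of ps a "r @ b # qs"] walk_edges_append[of "a # r" b qs] ps qs by simp
  have "distinct (p1 @ r @ q1)"
    using p1(1,2) q1(1,2) r(3,4) disj unfolding path_in_def by auto
  then have "distinct ?W" using ps qs by simp
  moreover have "set ?W = set p1 \<union> set r \<union> set q1" using ps qs by auto
  then have "set ?W \<subseteq> X" "A \<union> B \<subseteq> set ?W" using p1(2) q1(2) sub r(3) unfolding path_in_def by auto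
  moreover have "set (walk_edges ?W) \<subseteq> edges G"
    using p1(1) q1(1) walk_r unfolding we path_in_def by auto
  ultimately show ?thesis
    unfolding path_in_def using p1(4) q1(4) we by (intro exI[of _ ?W]) auto
qed

end

section \<open>The initial path\<close>

text \<open>Short thin components attached to \<open>v\<close> at both ends go into
  \<open>U\<close>. Counting leaves at most two other components that are large enough to need
  covering, and one path covers them.\<close>

lemma (in pair_graph) ex_path_covered:
  assumes conn: "connected_in (parcs G) (pverts G)" and v: "v \<in> pverts G" "3 \<le> card (nbhd G v)"
    and q: "card (pverts G) < card (nbhd G v) + 3 * q + 4"
  shows "\<exists>U W. path_covered G U W (q + 1)"
proof -
  let ?D = "thin G"
  let ?comp = "component (parcs G) ?D"
  \<comment> \<open>The bound \<open>q + 3\<close> is the \<open>j + 2\<close> of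
    \<open>path_covered\<close> for \<open>j = q + 1\<close>.\<close>
  define U where "U = \<Union>{C. ?comp C \<and> card (nbhd G v \<inter> C) = 2 \<and> card C \<le> q + 3}"
  have symE: "sym (parcs G)" using arc_sym unfolding sym_def by blast
  have vD: "v \<notin> ?D" using v(2) unfolding thin_def by auto
  have D: "?D \<subseteq> pverts G" "\<And>x. x \<in> ?D \<Longrightarrow> card (nbhd G x) \<le> 2" unfolding thin_def by auto
  have comp: "C \<subseteq> ?D" "C \<noteq> {}" "connected_in (parcs G) C"
    "\<And>x y. x \<in> C \<Longrightarrow> y \<in> ?D \<Longrightarrow> (x, y) \<in> parcs G \<Longrightarrow> y \<in> C"
    "C \<subseteq> pverts G" "v \<notin> C" "\<And>x. x \<in> C \<Longrightarrow> card (nbhd G x) \<le> 2" if "?comp C" for C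
    using that D vD unfolding component_def by blast+
  \<comment> \<open>The vertex \<open>v\<close> lies outside every component, so connectivity
    provides an outgoing edge, as \<open>edges_within_spanning_path\<close> requires.\<close>
  have leaves: "\<exists>z y. z \<in> C \<and> (z, y) \<in> parcs G \<and> y \<notin> C" if C: "?comp C" for C
  proof (rule ccontr)
    assume no: "\<not> ?thesis"
    obtain x where "x \<in> C" using comp(2)[OF C] by blast
    then have "C = pverts G" using connected_inD[OF conn _ comp(5)[OF C]] no by blast
    then show False using v(1) comp(6)[OF C] by blast
  qed
  have span: "\<exists>p. path_in C p \<and> set p = C \<and> edges_within G C \<subseteq> set (walk_edges p) \<and>
    nbhd G v \<inter> C \<subseteq> {hd p, last p}" if C: "?comp C" for C
  proof -
    obtain p where p: "path_in C p" "set p = C"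
      using ex_spanning_path[of C] comp[OF C] by blast
    have "nbhd G v \<inter> C \<subseteq> {hd p, last p}"
    proof
      fix x assume "x \<in> nbhd G v \<inter> C"
      then have "x \<in> C" "(x, v) \<in> parcs G" using arc_sym[of v x] by simp_all
      then show "x \<in> {hd p, last p}"
        using spanning_path_ends[OF p comp(7)[OF C], of x v] comp(6)[OF C] by simp
    qed
    moreover have "edges_within G C \<subseteq> set (walk_edges p)"
      using edges_within_spanning_path[OF p comp(7)[OF C]] leaves[OF C] by blast
    ultimately show ?thesis using p by blast
  qed
  have two: "card (nbhd G v \<inter> C) \<le> 2" if C: "?comp C" for C
  proof -
    obtain p where "nbhd G v \<inter> C \<subseteq> {hd p, last p}" using span[OF C] by blast
    then have "card (nbhd G v \<inter> C) \<le> card {hd p, last p}" by (intro card_mono) auto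
    then show ?thesis using card_insert_le_m1[of 2 "{last p}" "hd p"] by simp
  qed
  have loop: "nbhd G u \<subseteq> insert v C \<and> card (nbhd G u) = 2"
    if C: "?comp C" and "card (nbhd G v \<inter> C) = 2" "u \<in> C" for C u
  proof -
    obtain p where p: "path_in C p" "set p = C" "nbhd G v \<inter> C \<subseteq> {hd p, last p}"
      using span[OF C] by blast
    obtain x y where xy: "nbhd G v \<inter> C = {x, y}" "x \<noteq> y" using \<open>card (nbhd G v \<inter> C) = 2\<close> by (auto simp: card_2_iff)
    then have "hd p \<noteq> last p" "{hd p, last p} = nbhd G v \<inter> C" using p(3) by auto
    then have "(hd p, v) \<in> parcs G" "(last p, v) \<in> parcs G"
      using arc_sym[of v "hd p"] arc_sym[of v "last p"] in_nbhd[of _ G v] by blast+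
    then show ?thesis
      using closed_path_nbhd[OF p(1,2) comp(7)[OF C] comp(6)[OF C] _ _ \<open>hd p \<noteq> last p\<close> \<open>u \<in> C\<close>] by blast
  qed
  have U_comp: "\<exists>C. ?comp C \<and> card (nbhd G v \<inter> C) = 2 \<and> card C \<le> q + 3 \<and> x \<in> C \<and> C \<subseteq> U" if "x \<in> U" for x
    using that unfolding U_def by blast
  have U_sub: "U \<subseteq> ?D" unfolding U_def component_def by blast
  have nbhd_U: "nbhd G x \<subseteq> insert v U" "card (nbhd G x) = 2" if "x \<in> U" for x
    using U_comp[OF that] loop by blast+
  have vU: "v \<notin> U" using U_sub vD by blast
  have off_U: "C \<inter> U = {}" if C: "?comp C" "\<not> (card (nbhd G v \<inter> C) = 2 \<and> card C \<le> q + 3)" for C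
  proof (rule ccontr)
    assume "C \<inter> U \<noteq> {}"
    then obtain x where "x \<in> C" "x \<in> U" by blast
    then obtain K where "?comp K" "card (nbhd G v \<inter> K) = 2" "card K \<le> q + 3" "x \<in> K"
      using U_comp by blast
    then show False using component_eq[OF C(1), of K x] C(2) \<open>x \<in> C\<close> by blast
  qed
  \<comment> \<open>\<open>U\<close> is attached to the other vertices only through
    \<open>v\<close>. A closed set without \<open>v\<close> is thus closed in \<open>G\<close>, and
    one containing \<open>v\<close> becomes closed in \<open>G\<close> when \<open>U\<close> is
    added.\<close>
  have conn_U: "connected_in (parcs G) (pverts G - U)"
    unfolding connected_in_def
  proof (intro allI impI)
    fix S assume S: "S \<noteq> {}" "S \<subseteq> pverts G - U" "\<forall>x\<in>S. \<forall>y\<in>pverts G - U. (x, y) \<in> parcs G \<longrightarrow> y \<in> S"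
    then obtain s where s: "s \<in> S" by blast
    have vS: "v \<in> S"
    proof (rule ccontr)
      assume nv: "v \<notin> S"
      have "S = pverts G"
      proof (rule connected_inD[OF conn s])
        fix x y assume xy: "x \<in> S" "y \<in> pverts G" "(x, y) \<in> parcs G"
        have "y \<notin> U"
        proof
          assume "y \<in> U"
          then have "x \<in> insert v U" using nbhd_U(1)[of y] arc_sym[OF xy(3)] in_nbhd[of x G y] by blast
          then show False using xy(1) nv S(2) by blast
        qed
        then show "y \<in> S" using S(3) xy by blast
      qed (use S(2) in blast)
      then show False using nv v(1) by blast
    qed
    have "S \<union> U = pverts G"
    proof (rule connected_inD[OF conn, of v])
      show "v \<in> S \<union> U" using vS by blast
      show "S \<union> U \<subseteq> pverts G" using S(2) U_sub D(1) by blast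
      fix x y assume xy: "x \<in> S \<union> U" "y \<in> pverts G" "(x, y) \<in> parcs G"
      show "y \<in> S \<union> U"
      proof (cases "x \<in> U")
        case True
        then have "y \<in> insert v U" using nbhd_U(1)[of x] xy(3) in_nbhd[of y G x] by blast
        then show ?thesis using vS by blast
      qed (use xy S(3) in blast)
    qed
    then show "S = pverts G - U" using S(2) by blast
  qed
  \<comment> \<open>These are the components with more than \<open>j = q + 1\<close> vertices that
    do not belong to \<open>U\<close>.\<close>
  define B where "B = {C. ?comp C \<and> q + 2 \<le> card C \<and> \<not> (card (nbhd G v \<inter> C) = 2 \<and> card C \<le> q + 3)}"
  have at_most_two: "C = K1 \<or> C = K2" if "K1 \<in> B" "K2 \<in> B" "C \<in> B" "K1 \<noteq> K2" for C K1 K2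
  proof (rule ccontr)
    assume no: "\<not> ?thesis"
    let ?N = "nbhd G v"
    have fin: "finite X" if "X \<in> B" for X
      using that comp(5) pair_finite_verts finite_subset unfolding B_def by blast
    \<comment> \<open>Removing at most one neighbour of \<open>v\<close> leaves \<open>q + 1\<close>
      vertices; a component with two such neighbours has at least \<open>q + 4\<close> vertices,
      since it is not in \<open>U\<close>.\<close>
    have big: "q + 1 \<le> card (X - ?N)" if X: "X \<in> B" for X
    proof -
      have "card (X - ?N) = card X - card (?N \<inter> X)"
        using card_Diff_subset_Int[of X ?N] fin[OF X] by (simp add: Int_commute)
      moreover have "card (?N \<inter> X) \<le> 2" using two X unfolding B_def by blast
      moreover have "q + 2 \<le> card X" "card (?N \<inter> X) = 2 \<longrightarrow> q + 4 \<le> card X"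
        using X unfolding B_def by auto
      ultimately show ?thesis by linarith
    qed
    have comp_B: "?comp X" if "X \<in> B" for X using that unfolding B_def by blast
    have disj: "(X - ?N) \<inter> (Y - ?N) = {}" if XY: "X \<in> B" "Y \<in> B" "X \<noteq> Y" for X Y
      using component_eq[OF comp_B[OF XY(1)] comp_B[OF XY(2)]] XY(3) by blast
    have "?N \<subseteq> pverts G" using in_arcsD2 by auto
    \<comment> \<open>\<open>v\<close>, its neighbours and three such remainders are disjoint and
      would require \<open>card (nbhd G v) + 3 * q + 4\<close> vertices, against the assumption
      \<open>q\<close>.\<close>
    then have sub: "insert v (?N \<union> ((C - ?N) \<union> ((K1 - ?N) \<union> (K2 - ?N)))) \<subseteq> pverts G"
      using v(1) comp(5)[OF comp_B[OF that(1)]] comp(5)[OF comp_B[OF that(2)]]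
        comp(5)[OF comp_B[OF that(3)]] by blast
    have "v \<notin> ?N" using arc_neq by (metis in_nbhd)
    have "card (insert v (?N \<union> ((C - ?N) \<union> ((K1 - ?N) \<union> (K2 - ?N))))) =
      Suc (card (?N \<union> ((C - ?N) \<union> ((K1 - ?N) \<union> (K2 - ?N)))))"
    proof (rule card_insert_disjoint)
      show "finite (?N \<union> ((C - ?N) \<union> ((K1 - ?N) \<union> (K2 - ?N))))"
        using fin[OF that(1)] fin[OF that(2)] fin[OF that(3)] finite_nbhd[of v] by simp
      show "v \<notin> ?N \<union> ((C - ?N) \<union> ((K1 - ?N) \<union> (K2 - ?N)))"
        using comp(6)[OF comp_B[OF that(1)]] comp(6)[OF comp_B[OF that(2)]]
          comp(6)[OF comp_B[OF that(3)]] \<open>v \<notin> ?N\<close> by blast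
    qed
    also have "card (?N \<union> ((C - ?N) \<union> ((K1 - ?N) \<union> (K2 - ?N)))) =
        card ?N + card ((C - ?N) \<union> ((K1 - ?N) \<union> (K2 - ?N)))"
    proof (rule card_Un_disjoint)
      show "finite ((C - ?N) \<union> ((K1 - ?N) \<union> (K2 - ?N)))"
        using fin[OF that(1)] fin[OF that(2)] fin[OF that(3)] by simp
      show "?N \<inter> ((C - ?N) \<union> ((K1 - ?N) \<union> (K2 - ?N))) = {}" by blast
    qed (rule finite_nbhd)
    also have "card ((C - ?N) \<union> ((K1 - ?N) \<union> (K2 - ?N))) = card (C - ?N) + card ((K1 - ?N) \<union> (K2 - ?N))"
    proof (rule card_Un_disjoint)
      show "(C - ?N) \<inter> ((K1 - ?N) \<union> (K2 - ?N)) = {}"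
        using disj[OF that(3,1)] disj[OF that(3,2)] no by blast
    qed (use fin[OF that(1)] fin[OF that(2)] fin[OF that(3)] in simp_all)
    also have "card ((K1 - ?N) \<union> (K2 - ?N)) = card (K1 - ?N) + card (K2 - ?N)"
      using fin[OF that(1)] fin[OF that(2)] disj[OF that(1,2,4)]
      by (intro card_Un_disjoint) simp_all
    finally have "card (insert v (?N \<union> ((C - ?N) \<union> ((K1 - ?N) \<union> (K2 - ?N))))) =
      Suc (card ?N + (card (C - ?N) + (card (K1 - ?N) + card (K2 - ?N))))" .
    then have "Suc (card ?N + (card (C - ?N) + (card (K1 - ?N) + card (K2 - ?N)))) \<le> card (pverts G)"
      using card_mono[OF pair_finite_verts sub] by simp
    then show False using big[OF that(1)] big[OF that(2)] big[OF that(3)] q by linarith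
  qed
  have B: "?comp C" "C \<subseteq> pverts G - U" if "C \<in> B" for C
    using that off_U[of C] comp(5)[of C] unfolding B_def by blast+
  have "\<exists>W. path_in (pverts G - U) W \<and> (\<forall>C\<in>B. C \<subseteq> set W \<and> edges_within G C \<subseteq> set (walk_edges W))"
  proof (cases "B = {}")
    case True
    then show ?thesis by (intro exI[of _ "[]"]) (simp add: path_in_def)
  next
    case False
    then obtain K1 where K1: "K1 \<in> B" by blast
    obtain p where p: "path_in K1 p" "set p = K1" "edges_within G K1 \<subseteq> set (walk_edges p)"
      using span[OF B(1)[OF K1]] by blast
    show ?thesis
    proof (cases "B = {K1}")
      case True
      have "path_in (pverts G - U) p" using p(1) B(2)[OF K1] unfolding path_in_def by blast
      then show ?thesis using True p by blast
    next
      case False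
      then obtain K2 where K2: "K2 \<in> B" "K1 \<noteq> K2" using K1 by blast
      obtain r where r: "path_in K2 r" "set r = K2" "edges_within G K2 \<subseteq> set (walk_edges r)"
        using span[OF B(1)[OF K2(1)]] by blast
      note c1 = comp[OF B(1)[OF K1]] and c2 = comp[OF B(1)[OF K2(1)]]
      have disj: "K1 \<inter> K2 = {}"
        using component_eq[OF B(1)[OF K1] B(1)[OF K2(1)]] K2(2) by blast
      have "\<exists>W. path_in (pverts G - U) W \<and> K1 \<union> K2 \<subseteq> set W \<and>
        set (walk_edges p) \<union> set (walk_edges r) \<subseteq> set (walk_edges W)"
      proof (rule ex_path_through_two[OF conn_U B(2)[OF K1] B(2)[OF K2(1)] disj c1(2) c2(2) p(1,2) r(1,2)])
        show "card (nbhd G x) \<le> 2" if "x \<in> K1 \<union> K2" for x using that c1(7) c2(7) by blast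
        show "(x, y) \<notin> parcs G" if "x \<in> K1" "y \<in> K2" for x y
          using that c1(4)[of x y] c2(1) disj by blast
      qed
      then obtain W where "path_in (pverts G - U) W" "K1 \<union> K2 \<subseteq> set W"
        "set (walk_edges p) \<union> set (walk_edges r) \<subseteq> set (walk_edges W)" by blast
      moreover have "B = {K1, K2}" using at_most_two[OF K1 K2(1) _ K2(2)] K1 K2(1) by blast
      ultimately show ?thesis using p(3) r(3) by blast
    qed
  qed
  then obtain W where W: "path_in (pverts G - U) W"
    and W_B: "\<And>C. C \<in> B \<Longrightarrow> C \<subseteq> set W \<and> edges_within G C \<subseteq> set (walk_edges W)" by blast
  have "path_covered G U W (q + 1)"
  proof (unfold_locales)
    show "connected_in (parcs G) (pverts G)" by (rule conn)
    show "connected_in (parcs G) (pverts G - U)" by (rule conn_U)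
    show "U \<subseteq> pverts G" using U_sub D(1) by blast
    show "card (nbhd G x) = 2" if "x \<in> U" for x using nbhd_U(2)[OF that] .
    show "y \<in> U" if "x \<in> U" "y \<in> ?D" "(x, y) \<in> parcs G" for x y
      using U_comp[OF that(1)] comp(4) that(2,3) by blast
    show "\<not> pverts G \<subseteq> ?D \<union> U" using v(1) vD vU by blast
    show "distinct W" "set W \<subseteq> pverts G - U" "set (walk_edges W) \<subseteq> edges G"
      using W unfolding path_in_def by blast+
    show "card C \<le> q + 1 + 2" if C: "C \<subseteq> U" "C \<noteq> {}" "connected_in (parcs G) C" for C
    proof -
      obtain x where x: "x \<in> C" using C(2) by blast
      then obtain K where K: "?comp K" "card K \<le> q + 3" "x \<in> K" using U_comp C(1) by blast
      have "C \<subseteq> K" using connected_in_subset_component[OF K(1) C(3) _ x K(3)] C(1) U_sub by blast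
      then have "card C \<le> card K"
        using comp(5)[OF K(1)] pair_finite_verts finite_subset by (intro card_mono) blast+
      then show ?thesis using K(2) by simp
    qed
    \<comment> \<open>The thin component \<open>K\<close> around \<open>C\<close> has at least
      \<open>q + 2\<close> vertices and is not part of \<open>U\<close>, hence it is in
      \<open>B\<close>.\<close>
    show "C \<subseteq> set W \<and> edges_within G C \<subseteq> set (walk_edges W)"
      if C: "C \<subseteq> ?D - U" "connected_in (parcs G) C" "q + 1 < card C" for C
    proof -
      obtain x where x: "x \<in> C" using C(3) by fastforce
      then obtain K where K: "?comp K" "x \<in> K" using ex_component[OF symE, of x ?D] C(1) by blast
      have CK: "C \<subseteq> K" using connected_in_subset_component[OF K(1) C(2) _ x K(2)] C(1) by blast
      then have "card C \<le> card K"
        using comp(5)[OF K(1)] pair_finite_verts finite_subset by (intro card_mono) blast+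
      moreover have "\<not> (card (nbhd G v \<inter> K) = 2 \<and> card K \<le> q + 3)"
        using K x C(1) unfolding U_def by blast
      ultimately have "K \<in> B" using K(1) C(3) unfolding B_def by simp
      then show ?thesis using W_B CK unfolding edges_within_def by blast
    qed
  qed
  then show ?thesis by blast
qed

section \<open>Connectivity, degrees and the final bound\<close>

lemma (in pair_graph) connected_in_if_connected:
  assumes "connected (with_proj G)"
  shows "connected_in (parcs G) (pverts G)" "pverts G \<noteq> {}"
proof -
  have sc: "strongly_connected (with_proj G)"
    by (rule symmetric_connected_imp_strongly_connected[OF pair_sym_arcs assms])
  then show "pverts G \<noteq> {}" unfolding strongly_connected_def by simp
  show "connected_in (parcs G) (pverts G)"
    unfolding connected_in_def
  proof (intro allI impI)
    fix S assume S: "S \<noteq> {}" "S \<subseteq> pverts G" "\<forall>x\<in>S. \<forall>y\<in>pverts G. (x, y) \<in> parcs G \<longrightarrow> y \<in> S"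
    then obtain s where s: "s \<in> S" by blast
    have "y \<in> S" if y: "y \<in> pverts G" for y
    proof -
      have "s \<rightarrow>\<^sup>*\<^bsub>with_proj G\<^esub> y"
        using sc s S(2) y unfolding strongly_connected_def by auto
      then show ?thesis
      proof (induction rule: reachable_induct)
        case (step x z)
        then show ?case using S(3) in_arcsD2 by auto
      qed (rule s)
    qed
    then show "S = pverts G" using S(2) by blast
  qed
qed

lemma (in pair_graph) out_degree_eq: "out_degree (with_proj G) x = card (nbhd G x)"
proof -
  have "out_arcs (with_proj G) x = Pair x ` nbhd G x"
    unfolding out_arcs_def by auto
  then show ?thesis unfolding out_degree_def by (simp add: card_image inj_on_def)
qed

text \<open>This settles the case of maximum degree at most two, which
  \<open>ex_path_covered\<close> excludes: the graph is a path or a cycle.\<close>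

lemma (in pair_graph) traceable_if_max_degree_le_2:
  assumes "connected_in (parcs G) (pverts G)" "pverts G \<noteq> {}" "\<And>x. x \<in> pverts G \<Longrightarrow> card (nbhd G x) \<le> 2"
  shows "traceable G"
proof -
  obtain p where p: "path_in (pverts G) p" "set p = pverts G"
    using ex_spanning_path[OF _ assms(2,1,3)] by blast
  have "set (vwalk_arcs p) \<subseteq> parcs G" if "set (walk_edges p) \<subseteq> edges G" for p
    using that by (induction p rule: walk_edges.induct) auto
  then have "vpath p (with_proj G)"
    using p assms(2) unfolding path_in_def by (auto simp: vpath_def vwalk_def)
  then show ?thesis using p(2) unfolding traceable_def by blast
qed

lemma connected_in_relabel:
  assumes "connected_in (parcs G) (pverts G)"
  shows "connected_in (parcs (relabel \<phi> G)) (pverts (relabel \<phi> G))"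
  unfolding connected_in_def
proof (intro allI impI)
  fix S assume S: "S \<noteq> {}" "S \<subseteq> pverts (relabel \<phi> G)"
    "\<forall>x\<in>S. \<forall>y\<in>pverts (relabel \<phi> G). (x, y) \<in> parcs (relabel \<phi> G) \<longrightarrow> y \<in> S"
  obtain x where x: "x \<in> pverts G" "\<phi> x \<in> S" using S(1,2) by auto
  have "{x \<in> pverts G. \<phi> x \<in> S} = pverts G"
  proof (rule connected_inD[OF assms, of x])
    fix x y assume xy: "x \<in> {x \<in> pverts G. \<phi> x \<in> S}" "y \<in> pverts G" "(x, y) \<in> parcs G"
    then have "(\<phi> x, \<phi> y) \<in> parcs (relabel \<phi> G)" by force
    then show "y \<in> {x \<in> pverts G. \<phi> x \<in> S}" using S(3) xy by auto
  qed (use x in auto)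
  then show "S = pverts (relabel \<phi> G)" using S(2) by auto
qed

lemma nbhd_relabel:
  assumes "inj \<phi>"
  shows "nbhd (relabel \<phi> G) (\<phi> x) = \<phi> ` nbhd G x"
proof (intro equalityI subsetI)
  fix y assume "y \<in> nbhd (relabel \<phi> G) (\<phi> x)"
  then obtain a b where "\<phi> a = \<phi> x" "y = \<phi> b" "(a, b) \<in> parcs G"
    by auto
  then show "y \<in> \<phi> ` nbhd G x" using injD[OF assms, of a x] by auto
next
  fix y assume "y \<in> \<phi> ` nbhd G x"
  then show "y \<in> nbhd (relabel \<phi> G) (\<phi> x)" by force
qed

theorem corollary20:
  fixes G :: "'a pair_pre_digraph" and n :: nat
  assumes "pair_graph G"
    and "Digraph_Component.connected (with_proj G)"
    and "card (pverts G) = n"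
  shows "ham_path_index G \<le> enat ((n - max_degree G) div 3 + 3)"
proof -
  interpret pair_graph G by fact
  let ?H = "iter_line_graph 0 G"
  note conn = connected_in_if_connected[OF assms(2)]
  have deg: "max_degree G = Max ((\<lambda>x. card (nbhd G x)) ` pverts G)"
    unfolding max_degree_def by (simp add: out_degree_eq)
  show ?thesis
  proof (cases "max_degree G \<le> 2")
    case True
    then have "card (nbhd G x) \<le> 2" if "x \<in> pverts G" for x
      using Max_ge[of "(\<lambda>x. card (nbhd G x)) ` pverts G" "card (nbhd G x)"] that pair_finite_verts
      unfolding deg by (meson finite_imageI imageI order_trans)
    then have "traceable G" using traceable_if_max_degree_le_2 conn by blast
    then have "traceable ?H" by (simp add: traceable_relabel inj_on_def)
    then have "ham_path_index G \<le> enat 0"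
      unfolding ham_path_index_def by (intro Inf_lower) auto
    then show ?thesis by (rule order_trans) simp
  next
    case False
    have "Max ((\<lambda>x. card (nbhd G x)) ` pverts G) \<in> (\<lambda>x. card (nbhd G x)) ` pverts G"
      using pair_finite_verts conn(2) by (intro Max_in) auto
    then obtain v where v: "v \<in> pverts G" "card (nbhd G v) = max_degree G"
      unfolding deg by auto
    \<comment> \<open>Division by three gives \<open>n < max_degree G + 3 * ?q + 3\<close>, which
      implies the counting hypothesis of \<open>ex_path_covered\<close>. With
      \<open>j = ?q + 1\<close> the index is at most \<open>j + 2 = ?q + 3\<close>.\<close>
    let ?q = "(n - max_degree G) div 3"
    have inj: "inj (Vertex :: 'a \<Rightarrow> _)" by (simp add: inj_def)
    have "card (pverts ?H) = n" using assms(3) inj by (simp add: card_image inj_on_subset)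
    moreover have "card (nbhd ?H (Vertex v)) = max_degree G"
      using nbhd_relabel[OF inj, of G v] v(2) inj by (simp add: card_image inj_on_subset)
    ultimately have "\<exists>U W. path_covered ?H U W (?q + 1)"
      using False v(1) connected_in_relabel[OF conn(1)]
      by (intro pair_graph.ex_path_covered[of ?H "Vertex v"] pair_graph_iter_line_graph assms(1)) auto
    then obtain U W where "path_covered ?H U W (?q + 1)" by blast
    then have "ham_path_index G \<le> enat (?q + 1 + 2)"
      by (rule path_covered_iter_line_graph[OF assms(1)])
    also have "?q + 1 + 2 = ?q + 3" by linarith
    finally show ?thesis .
  qed
qed

end
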